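(* Let $d\ge2$ be an integer, $\eta>0$, $\alpha>d$ and $\beta>1$. Let $\theta_d$ be the Lebesgue volume of the Euclidean unit ball $B(O,1)$ in $\mathbb{R}^d$ and let $$\kappa=\int_{B(O,1)}E\left[1-\exp\left(-\frac{\eta W}{|z|^{\alpha}}\right)\right]dz,$$ where $W$ is a random variable with $P(W>w)=w^{-\beta}$ for $w\ge1$ and $W\ge 1$ a.s. For $\gamma>0$ and $s>1$ let $\hat r_s(\gamma)>0$ be given by $\hat r_s(\gamma)^d=\dfrac{\gamma\log s}{\kappa s}$, and define $$T(\gamma)=1-\exp\left\{-\eta\left(1+\left(\frac{\kappa}{\gamma\theta_d}\right)^{1/d}\right)^{-\alpha}\right\},\qquad Q(\gamma)=\gamma\,T(\gamma).$$ Let $\rho>0$ be the unique solution of $Q(\rho)=1$. Then for every $\gamma>\rho$, $$P\big(G(\mathcal{P}_s,\hat r_s(\gamma))\text{ is connected}\big)\to1\qquad\text{as }s\to\infty.$$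
   Context: Let $S=\left(-\frac12,\frac12\right]^d$ with the toroidal metric $d(x,y)=\inf\{\|x-y-z\|: z\in\mathbb{Z}^d\}$, where $\|\cdot\|$ is the Euclidean norm. For $s>0$ let $\mathcal{P}_s$ be a homogeneous Poisson point process of intensity $s$ on $S$. Each point $x\in\mathcal{P}_s$ carries a weight $W_x$; the weights are i.i.d., independent of $\mathcal{P}_s$, with $P(W_x>w)=w^{-\beta}$ for $w\ge 1$ (and $W_x\ge1$ a.s.). For $r>0$, $G(\mathcal{P}_s,r)$ is the random graph with vertex set $\mathcal{P}_s$ in which, given the points and the weights, each pair of distinct vertices $x,y$ is joined by an edge, independently of all other pairs, with probability $$1-\exp\left(-\frac{\eta W_xW_y}{(d(x,y)/r)^{\alpha}}\right).$$ The function $Q$ is continuous and strictly increasing with $Q(0^+)=0$ and $Q(\gamma)\to\infty$ as $\gamma\to\infty$, so $\rho$ is well defined. *)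

theory Defs
  imports "HOL-Probability.Probability"
begin

text \<open>The dimension is \<open>d = CARD('n)\<close>.\<close>

definition torus :: "(real ^ 'n) set" where
  "torus = {x. \<forall>i. - (1/2) < x $ i \<and> x $ i \<le> 1/2}"

definition torus_dist :: "real ^ 'n \<Rightarrow> real ^ 'n \<Rightarrow> real" where
  "torus_dist x y = Inf {norm (x - y - z) | z. \<forall>i. z $ i \<in> \<int>}"

text \<open>
  A finite random set of points is given by its cardinality \<open>N\<close> together with a measurable
  enumeration without repetition \<open>X 0, \<dots>, X (N - 1)\<close>. Nothing is assumed about the order of the
  enumeration, and the values \<open>X i \<omega>\<close> with \<open>N \<omega> \<le> i\<close> are padding that does not enter the graph.
\<close>

definition point_set :: "('w \<Rightarrow> nat) \<Rightarrow> (nat \<Rightarrow> 'w \<Rightarrow> 'p) \<Rightarrow> 'w \<Rightarrow> 'p set" where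
  "point_set N X \<omega> = (\<lambda>i. X i \<omega>) ` {..<N \<omega>}"

locale torus_poisson_process = prob_space M
  for M :: "'w measure" +
  fixes s :: real
    and N :: "'w \<Rightarrow> nat"
    and X :: "nat \<Rightarrow> 'w \<Rightarrow> real ^ 'n"
  assumes number_measurable: "N \<in> measurable M (count_space UNIV)"
    and point_measurable: "\<And>i. X i \<in> borel_measurable M"
    and point_in_torus: "\<And>\<omega> i. \<omega> \<in> space M \<Longrightarrow> i < N \<omega> \<Longrightarrow> X i \<omega> \<in> torus"
    and points_distinct: "\<And>\<omega>. \<omega> \<in> space M \<Longrightarrow> inj_on (\<lambda>i. X i \<omega>) {..<N \<omega>}"
    and count_poisson: "\<And>A k. A \<in> sets borel \<Longrightarrow> A \<subseteq> torus \<Longrightarrow>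
      prob {\<omega> \<in> space M. card (point_set N X \<omega> \<inter> A) = k}
        = (s * measure lborel A) ^ k / fact k * exp (- (s * measure lborel A))"
    and count_indep: "\<And>(A :: nat \<Rightarrow> (real ^ 'n) set) m.
      (\<And>i. i < m \<Longrightarrow> A i \<in> sets borel \<and> A i \<subseteq> torus) \<Longrightarrow> disjoint_family_on A {..<m} \<Longrightarrow>
      indep_vars (\<lambda>_. count_space UNIV) (\<lambda>i \<omega>. card (point_set N X \<omega> \<inter> A i)) {..<m}"

definition weight_law :: "real \<Rightarrow> real measure \<Rightarrow> bool" where
  "weight_law \<beta> \<mu> \<longleftrightarrow> prob_space \<mu> \<and> sets \<mu> = sets borel \<and>
     (\<forall>w\<ge>1. measure \<mu> {w<..} = w powr (- \<beta>)) \<and> (AE w in \<mu>. 1 \<le> w)"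

definition connection_prob ::
  "real \<Rightarrow> real \<Rightarrow> real \<Rightarrow> real ^ 'n \<Rightarrow> real \<Rightarrow> real ^ 'n \<Rightarrow> real \<Rightarrow> real" where
  "connection_prob \<eta> \<alpha> r x wx y wy =
     1 - exp (- ((\<eta> * wx * wy) / ((torus_dist x y / r) powr \<alpha>)))"

text \<open>
  The weight of the point \<open>X i\<close> is \<open>W i\<close>. The graph has vertex set \<open>point_set N X \<omega>\<close> and edge set
  \<open>E \<omega>\<close>, edges being two-element sets of vertices. The conditional law of the edges given the points
  and weights is prescribed by conditional expectation: the conditional probability that all of
  finitely many distinct pairs are edges is the product of the connection probabilities.
\<close>

definition points_weights_algebra ::
  "'w measure \<Rightarrow> ('w \<Rightarrow> nat) \<Rightarrow> (nat \<Rightarrow> 'w \<Rightarrow> real ^ 'n) \<Rightarrow> (nat \<Rightarrow> 'w \<Rightarrow> real) \<Rightarrow> 'w measure" where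
  "points_weights_algebra M N X W =
     vimage_algebra (space M) (\<lambda>\<omega>. (N \<omega>, (\<lambda>i. X i \<omega>), (\<lambda>i. W i \<omega>)))
       (count_space UNIV \<Otimes>\<^sub>M PiM UNIV (\<lambda>_. borel) \<Otimes>\<^sub>M PiM UNIV (\<lambda>_. borel))"

locale weighted_random_graph = torus_poisson_process M s N X
  for M :: "'w measure" and s :: real and N :: "'w \<Rightarrow> nat" and X :: "nat \<Rightarrow> 'w \<Rightarrow> real ^ 'n" +
  fixes \<eta> \<alpha> \<beta> r :: real
    and W :: "nat \<Rightarrow> 'w \<Rightarrow> real"
    and E :: "'w \<Rightarrow> (real ^ 'n) set set"
  assumes weight_indep: "indep_vars (\<lambda>_. borel) W UNIV"
    and weight_distr: "\<And>i. weight_law \<beta> (distr M borel (W i))"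
    and weights_indep_points:
      "indep_set
         (sets (vimage_algebra (space M) (\<lambda>\<omega> i. W i \<omega>) (PiM UNIV (\<lambda>_. borel))))
         (sets (vimage_algebra (space M) (\<lambda>\<omega>. (N \<omega>, \<lambda>i. X i \<omega>))
            (count_space UNIV \<Otimes>\<^sub>M PiM UNIV (\<lambda>_. borel))))"
    and edges_between_points: "\<And>\<omega> e. \<omega> \<in> space M \<Longrightarrow> e \<in> E \<omega> \<Longrightarrow>
      \<exists>x\<in>point_set N X \<omega>. \<exists>y\<in>point_set N X \<omega>. x \<noteq> y \<and> e = {x, y}"
    and edge_event: "\<And>i j. i < j \<Longrightarrow>
      {\<omega> \<in> space M. j < N \<omega> \<and> {X i \<omega>, X j \<omega>} \<in> E \<omega>} \<in> events"
    and edges_cond_law: "\<And>J :: (nat \<times> nat) set.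
      finite J \<Longrightarrow> J \<subseteq> {(i, j). i < j} \<Longrightarrow>
      AE \<omega> in M. (\<forall>(i, j)\<in>J. j < N \<omega>) \<longrightarrow>
        real_cond_exp M (points_weights_algebra M N X W)
          (indicator {\<omega> \<in> space M. \<forall>(i, j)\<in>J. j < N \<omega> \<and> {X i \<omega>, X j \<omega>} \<in> E \<omega>}) \<omega>
        = (\<Prod>(i, j)\<in>J. connection_prob \<eta> \<alpha> r (X i \<omega>) (W i \<omega>) (X j \<omega>) (W j \<omega>))"

definition graph_connected :: "'p set \<Rightarrow> 'p set set \<Rightarrow> bool" where
  "graph_connected V E \<longleftrightarrow>
     (\<forall>x\<in>V. \<forall>y\<in>V. (x, y) \<in> {(u, v). u \<in> V \<and> v \<in> V \<and> {u, v} \<in> E}\<^sup>*)"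

end

theory Submission
  imports Defs "HOL-Real_Asymp.Real_Asymp"
begin

text \<open>
  Weights are at least 1, so two vertices at distance at most \<open>a r\<close> are joined with probability at
  least \<open>1 - exp (- \<eta> a powr (- \<alpha>))\<close>, conditionally independently of all other pairs. This is
  applied for \<open>a = 1\<close> and for \<open>a = 6\<close>.

  A ball of radius \<open>r\<close> contains on average \<open>s \<theta> r\<^sup>d = (\<theta> \<gamma> / \<kappa>) log s \<ge> \<gamma> log s\<close> points, because the
  integrand in \<open>\<kappa>\<close> is at most 1. Hence a vertex has on average at least \<open>\<gamma> p log s\<close> neighbours within
  distance \<open>r\<close>, with \<open>p = 1 - exp (- \<eta>)\<close>. Now \<open>T(\<rho>) \<le> p\<close>, so \<open>\<gamma> > \<rho>\<close> gives
  \<open>\<gamma> p > \<rho> T(\<rho>) = Q(\<rho>) = 1\<close>. By a Chernoff bound (\<open>prob_few_neighbours_event_le\<close>), the probability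
  that near a given place there is a vertex with fewer than \<open>\<epsilon> log s\<close> such neighbours is at most
  \<open>s powr (- b)\<close> with some \<open>b > 1\<close>, up to a factor \<open>log s\<close>; the probability that the ball of radius
  \<open>r\<close> around the place is empty is even smaller. It suffices to examine the \<open>O(s / log s)\<close> centres of
  a net of mesh proportional to \<open>r\<close>, at the cost of shrinking the radius of the balls a little, so with
  probability tending to 1 neither happens anywhere.

  A ball of radius \<open>3 r\<close> contains \<open>O(log s)\<close> points on average, so the expected number of
  pairs of disjoint vertex sets in it is at most a power of \<open>s\<close>. If both sets have at least
  \<open>\<epsilon> log s\<close> elements, then the probability that no edge joins them is at most
  \<open>exp (- h (log s)\<^sup>2)\<close> with some \<open>h > 0\<close>. So with probability tending to 1 any two such sets are joined
  by an edge (\<open>prob_separated_event_le\<close>).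

  These properties imply connectivity (\<open>graph_connected_if_no_bad_event\<close>): the neighbourhoods of
  two nearby vertices meet or are joined by an edge, which connects the two vertices, and since no
  ball of radius \<open>r\<close> is empty, any two vertices are linked by a chain of nearby ones.

  The law of the points enters through generating functions of the Poisson counts of regions
  (\<open>poisson_pgf\<close>, \<open>poisson_pgf_deriv\<close>), and the law of the edges through the expectation of products
  over pairs of indices (\<open>expectation_edges_product\<close>), on events on which the index sets
  of the points in the relevant regions are constant (\<open>nn_integral_mono_fibres\<close>).
\<close>

section \<open>Lattice translates and balls in the torus\<close>

definition lattice :: "(real ^ 'n) set" where
  "lattice = {z. \<forall>i. z $ i \<in> \<int>}"

definition torus_ball :: "real ^ 'n \<Rightarrow> real \<Rightarrow> (real ^ 'n) set" where
  "torus_ball c \<epsilon> = {y \<in> torus. torus_dist c y < \<epsilon>}"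

lemma zero_in_lattice: "0 \<in> lattice"
  by (simp add: lattice_def)

lemma uminus_in_lattice: "z \<in> lattice \<Longrightarrow> - z \<in> lattice"
  by (simp add: lattice_def)

lemma add_in_lattice: "z \<in> lattice \<Longrightarrow> w \<in> lattice \<Longrightarrow> z + w \<in> lattice"
  by (simp add: lattice_def)

lemma countable_lattice: "countable (lattice :: (real ^ 'n) set)"
proof -
  have "(lattice :: (real ^ 'n) set) \<subseteq> range (\<lambda>f :: 'n \<Rightarrow> int. \<chi> i. real_of_int (f i))"
  proof
    fix z :: "real ^ 'n" assume "z \<in> lattice"
    then have "\<forall>i. z $ i = real_of_int \<lfloor>z $ i\<rfloor>" by (auto simp: lattice_def elim: Ints_cases)
    then have "z = (\<chi> i. real_of_int \<lfloor>z $ i\<rfloor>)" by (simp add: vec_eq_iff)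
    then show "z \<in> range (\<lambda>f :: 'n \<Rightarrow> int. \<chi> i. real_of_int (f i))"
      by (rule image_eqI[where x = "\<lambda>i. \<lfloor>z $ i\<rfloor>"]) simp
  qed
  then show ?thesis by (rule countable_subset) simp
qed

lemma lattice_eq_if_close:
  assumes "z \<in> lattice" "w \<in> lattice" "\<And>i. \<bar>z $ i - w $ i\<bar> < 1"
  shows "z = w"
proof -
  have "z $ i = w $ i" for i
  proof -
    have "z $ i - w $ i \<in> \<int>" using assms(1,2) by (simp add: lattice_def)
    then have "z $ i - w $ i = 0" using assms(3)[of i] Ints_nonzero_abs_less1 by blast
    then show ?thesis by simp
  qed
  then show ?thesis by (simp add: vec_eq_iff)
qed

lemma torus_dist_less_iff:
  "torus_dist x y < \<epsilon> \<longleftrightarrow> (\<exists>z\<in>lattice. norm (x - y - z) < \<epsilon>)"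
proof -
  let ?S = "{norm (x - y - z) | z. \<forall>i. z $ i \<in> \<int>}"
  have "norm (x - y - 0) \<in> ?S" by (rule CollectI, rule exI[of _ 0]) simp
  then have "?S \<noteq> {}" by blast
  moreover have "bdd_below ?S" by (rule bdd_belowI[of _ 0]) auto
  ultimately have "Inf ?S < \<epsilon> \<longleftrightarrow> (\<exists>a\<in>?S. a < \<epsilon>)" by (rule cInf_less_iff)
  then show ?thesis by (auto simp: torus_dist_def lattice_def)
qed

lemma torus_dist_le_norm: "torus_dist x y \<le> norm (x - y)"
proof (rule field_le_epsilon)
  fix e :: real assume "e > 0"
  then have "torus_dist x y < norm (x - y) + e"
    using zero_in_lattice by (auto simp: torus_dist_less_iff intro!: bexI[of _ 0])
  then show "torus_dist x y \<le> norm (x - y) + e" by simp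
qed

lemma torus_dist_commute: "torus_dist x y = torus_dist y x"
proof -
  have "torus_dist x y \<le> torus_dist y x" for x y :: "real ^ 'n"
  proof (rule field_le_epsilon)
    fix e :: real assume "e > 0"
    then obtain z where "z \<in> lattice" "norm (y - x - z) < torus_dist y x + e"
      using torus_dist_less_iff[of y x "torus_dist y x + e"] by auto
    moreover have "norm (x - y - (- z)) = norm (y - x - z)"
      by (metis minus_diff_eq minus_diff_minus norm_minus_cancel)
    ultimately have "torus_dist x y < torus_dist y x + e"
      using uminus_in_lattice unfolding torus_dist_less_iff by metis
    then show "torus_dist x y \<le> torus_dist y x + e" by simp
  qed
  then show ?thesis by (metis order_antisym)
qed

lemma torus_dist_triangle: "torus_dist x z \<le> torus_dist x y + torus_dist y z"
proof (rule field_le_epsilon)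
  fix e :: real assume "e > 0"
  then obtain u v where u: "u \<in> lattice" "norm (x - y - u) < torus_dist x y + e / 2"
    and v: "v \<in> lattice" "norm (y - z - v) < torus_dist y z + e / 2"
    using torus_dist_less_iff[of x y "torus_dist x y + e / 2"]
      torus_dist_less_iff[of y z "torus_dist y z + e / 2"] by auto
  have "norm (x - z - (u + v)) = norm ((x - y - u) + (y - z - v))" by (simp add: algebra_simps)
  also have "\<dots> \<le> norm (x - y - u) + norm (y - z - v)" by (rule norm_triangle_ineq)
  also have "\<dots> < torus_dist x y + torus_dist y z + e" using u v by simp
  finally show "torus_dist x z \<le> torus_dist x y + torus_dist y z + e"
    using add_in_lattice[OF u(1) v(1)] torus_dist_less_iff less_imp_le by blast
qed

lemma torus_dist_pos:
  assumes "x \<in> torus" "y \<in> torus" "x \<noteq> y"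
  shows "0 < torus_dist x y"
proof -
  obtain i where i: "x $ i \<noteq> y $ i" using assms(3) by (auto simp: vec_eq_iff)
  define a where "a = x $ i - y $ i"
  have xi: "- (1/2) < x $ i" "x $ i \<le> 1/2" "- (1/2) < y $ i" "y $ i \<le> 1/2"
    using assms(1,2) by (auto simp: torus_def)
  have a: "a \<noteq> 0" "\<bar>a\<bar> < 1" using i xi by (auto simp: a_def)
  define m where "m = min \<bar>a\<bar> (1 - \<bar>a\<bar>)"
  have "m > 0" using a by (simp add: m_def)
  have "m \<le> norm (x - y - z)" if "z \<in> lattice" for z
  proof -
    have "z $ i \<in> \<int>" using that by (simp add: lattice_def)
    then have "z $ i = 0 \<or> \<bar>z $ i\<bar> \<ge> 1" using Ints_nonzero_abs_less1 by fastforce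
    then have "m \<le> \<bar>a - z $ i\<bar>" by (auto simp: m_def)
    also have "\<dots> = \<bar>(x - y - z) $ i\<bar>" by (simp add: a_def)
    also have "\<dots> \<le> norm (x - y - z)" by (rule component_le_norm_cart)
    finally show ?thesis .
  qed
  then have "\<not> torus_dist x y < m" by (auto simp: torus_dist_less_iff not_less)
  then show ?thesis using \<open>m > 0\<close> by simp
qed

lemma torus_in_sets: "(torus :: (real ^ 'n) set) \<in> sets borel"
proof -
  have "Measurable.pred borel (\<lambda>x :: real ^ 'n. \<forall>i. - (1/2) < x $ i \<and> x $ i \<le> 1/2)"
    by measurable
  then show ?thesis unfolding torus_def by (simp add: pred_def)
qed

lemma torus_ball_eq: "torus_ball c \<epsilon> = (\<Union>z\<in>lattice. torus \<inter> ball (c - z) \<epsilon>)"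
  unfolding torus_ball_def torus_dist_less_iff
  by (auto simp: dist_norm algebra_simps)

lemma torus_ball_in_sets: "torus_ball c \<epsilon> \<in> sets borel"
  unfolding torus_ball_eq
  by (intro sets.countable_UN'' countable_lattice sets.Int torus_in_sets) auto

lemma torus_ball_subset: "torus_ball c \<epsilon> \<subseteq> torus"
  by (auto simp: torus_ball_def)

lemma emeasure_lborel_translate:
  fixes A :: "(real ^ 'n) set"
  assumes "A \<in> sets borel"
  shows "emeasure lborel ((\<lambda>x. x + a) -` A) = emeasure lborel A"
proof -
  have "emeasure lborel A = emeasure (distr lborel borel ((+) a)) A" by (simp add: lborel_distr_plus)
  also have "\<dots> = emeasure lborel ((+) a -` A \<inter> space lborel)"
    by (rule emeasure_distr) (use assms in auto)
  also have "(+) a -` A \<inter> space lborel = (\<lambda>x. x + a) -` A" by (auto simp: add.commute)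
  finally show ?thesis by simp
qed

lemma exists_lattice_translate_in_torus: "\<exists>z\<in>lattice. (x :: real ^ 'n) - z \<in> torus"
proof -
  define z :: "real ^ 'n" where "z = (\<chi> i. of_int \<lceil>x $ i - 1/2\<rceil>)"
  have "z \<in> lattice" by (simp add: z_def lattice_def)
  moreover have "x - z \<in> torus" unfolding torus_def z_def
    by (auto; linarith)
  ultimately show ?thesis by blast
qed

text \<open>
  Cutting the Euclidean ball along the lattice translates of the torus and moving every piece back
  into the torus yields the toroidal ball. As the diameter is at most 1, the moved pieces do not
  overlap, so nothing is lost.
\<close>

lemma measure_torus_ball:
  fixes c :: "real ^ 'n"
  assumes "0 < \<epsilon>" "\<epsilon> \<le> 1/2"
  shows "measure lborel (torus_ball c \<epsilon>) = measure lborel (ball (0 :: real ^ 'n) 1) * \<epsilon> ^ CARD('n)"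
proof -
  define P where "P z = torus \<inter> ball (c - z) \<epsilon>" for z :: "real ^ 'n"
  define R where "R z = (\<lambda>x. x + (- z)) -` torus \<inter> ball c \<epsilon>" for z :: "real ^ 'n"
  have P_sets: "P z \<in> sets lborel" for z unfolding P_def by (simp add: torus_in_sets sets.Int)
  have shift: "(\<lambda>x. x + (- z)) -` P z = R z" for z
    by (auto simp: P_def R_def dist_norm algebra_simps)
  have R_sets: "R z \<in> sets lborel" for z
  proof -
    have "(\<lambda>x. x + (- z)) -` P z \<inter> space lborel \<in> sets lborel"
      by (rule measurable_sets[OF _ P_sets]) simp
    then show ?thesis using shift by simp
  qed
  have R_eq: "emeasure lborel (R z) = emeasure lborel (P z)" for z
    using emeasure_lborel_translate[of "P z" "- z"] P_sets shift by simp
  have "disjoint_family_on P lattice"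
    unfolding disjoint_family_on_def
  proof (intro ballI impI)
    fix z w :: "real ^ 'n" assume zw: "z \<in> lattice" "w \<in> lattice" "z \<noteq> w"
    show "P z \<inter> P w = {}"
    proof (rule ccontr)
      assume "P z \<inter> P w \<noteq> {}"
      then obtain y where "norm (c - z - y) < \<epsilon>" "norm (c - w - y) < \<epsilon>"
        by (auto simp: P_def dist_norm)
      moreover have "norm ((c - w - y) - (c - z - y)) \<le> norm (c - w - y) + norm (c - z - y)"
        by (rule norm_triangle_ineq4)
      ultimately have "norm (z - w) < 1" using assms(2) by simp
      then have "\<bar>z $ i - w $ i\<bar> < 1" for i
        using component_le_norm_cart[of "z - w" i] by simp
      then show False using lattice_eq_if_close zw by blast
    qed
  qed
  moreover have "disjoint_family_on R lattice"
    unfolding disjoint_family_on_def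
  proof (intro ballI impI)
    fix z w :: "real ^ 'n" assume zw: "z \<in> lattice" "w \<in> lattice" "z \<noteq> w"
    show "R z \<inter> R w = {}"
    proof (rule ccontr)
      assume "R z \<inter> R w \<noteq> {}"
      then obtain y where "y - z \<in> torus" "y - w \<in> torus" by (auto simp: R_def)
      then have b: "- (1/2) < y $ i - z $ i" "y $ i - z $ i \<le> 1/2"
        "- (1/2) < y $ i - w $ i" "y $ i - w $ i \<le> 1/2" for i
        by (auto simp: torus_def)
      have "\<bar>z $ i - w $ i\<bar> < 1" for i using b[of i] by linarith
      then show False using lattice_eq_if_close zw by blast
    qed
  qed
  moreover have "torus_ball c \<epsilon> = \<Union> (P ` lattice)" by (simp add: torus_ball_eq P_def)
  moreover have "ball c \<epsilon> = \<Union> (R ` lattice)"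
    using exists_lattice_translate_in_torus by (auto simp: R_def)
  ultimately have "emeasure lborel (torus_ball c \<epsilon>) = emeasure lborel (ball c \<epsilon>)"
    using emeasure_UN_countable[of lattice P lborel] emeasure_UN_countable[of lattice R lborel]
      P_sets R_sets countable_lattice[where 'n = 'n] by (simp add: R_eq)
  then have "measure lborel (torus_ball c \<epsilon>) = measure lborel (ball c \<epsilon>)"
    by (simp add: measure_def)
  then show ?thesis using assms content_ball[of \<epsilon> c] content_ball[of 1 "0 :: real ^ 'n"] by simp
qed

text \<open>
  Centres of a net replace a sum over the random vertices by a sum over fixed places. The order of
  magnitude of their number matters: for mesh proportional to \<open>r\<close> it is \<open>O(r\<^sup>-\<^sup>d)\<close>, that is
  \<open>O(s / log s)\<close>, which is what the local estimates can afford.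
\<close>

lemma torus_finite_net:
  assumes "0 < \<epsilon>" "\<epsilon> \<le> 1"
  obtains C :: "(real ^ 'n) set"
  where "finite C" "C \<subseteq> torus" "\<And>p. p \<in> torus \<Longrightarrow> \<exists>c\<in>C. norm (c - p) \<le> \<epsilon>"
    "real (card C) \<le> (2 * real CARD('n) / \<epsilon>) ^ CARD('n)"
proof -
  define d where "d = real CARD('n)"
  have d: "d \<ge> 1" by (simp add: d_def Suc_le_eq)
  define n where "n = nat \<lceil>d / \<epsilon>\<rceil>"
  have n_ge: "d / \<epsilon> \<le> real n" unfolding n_def by linarith
  have dpos: "d / \<epsilon> \<ge> 1" using d assms by (simp add: le_divide_eq)
  have n_le: "real n \<le> 2 * d / \<epsilon>" using dpos unfolding n_def by simp linarith
  have n_pos: "n > 0" using n_ge dpos by (cases n) auto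
  have side: "d * (1 / n) \<le> \<epsilon>" using n_ge assms n_pos by (simp add: field_simps)
  define K :: "('n \<Rightarrow> nat) set" where "K = (UNIV :: 'n set) \<rightarrow>\<^sub>E {..<n}"
  \<comment> \<open>The upper corners of the cells, as they belong to the half-open torus.\<close>
  define c where "c k = (\<chi> i. - (1/2) + (real (k i) + 1) / n)" for k :: "'n \<Rightarrow> nat"
  have finK: "finite K" unfolding K_def by (rule finite_PiE) auto
  have cardK: "card K = n ^ CARD('n)" unfolding K_def by (simp add: card_PiE)
  show ?thesis
  proof (rule that[of "c ` K"])
    show "finite (c ` K)" using finK by simp
    show "c ` K \<subseteq> torus"
    proof
      fix x assume "x \<in> c ` K"
      then obtain k where k: "k \<in> K" "x = c k" by blast
      have "k i < n" for i using k(1) by (auto simp: K_def)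
      then have "real (k i) + 1 \<le> n" for i by (metis Suc_leI add.commute of_nat_Suc of_nat_le_iff)
      then have frac: "0 < (real (k i) + 1) / n \<and> (real (k i) + 1) / n \<le> 1" for i
        using n_pos by (simp add: divide_le_eq add_nonneg_pos)
      have "- (1/2) < c k $ i \<and> c k $ i \<le> 1/2" for i
        unfolding c_def vec_lambda_beta using frac[of i] by linarith
      then show "x \<in> torus" by (simp add: torus_def k(2))
    qed
    show "\<exists>c\<in>c ` K. norm (c - p) \<le> \<epsilon>" if "p \<in> torus" for p
    proof -
      define k where "k i = nat (\<lceil>n * (p $ i + 1/2)\<rceil> - 1)" for i
      have p: "0 < p $ i + 1/2 \<and> p $ i + 1/2 \<le> 1" for i
      proof -
        have "- (1/2) < p $ i" "p $ i \<le> 1/2" using that by (simp_all add: torus_def)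
        then show ?thesis by simp
      qed
      have pos: "0 < n * (p $ i + 1/2)" "n * (p $ i + 1/2) \<le> n" for i
        using p[of i] n_pos by (auto simp: mult_le_cancel_left1)
      have ceil: "1 \<le> \<lceil>n * (p $ i + 1/2)\<rceil>" "\<lceil>n * (p $ i + 1/2)\<rceil> \<le> n" for i
        using pos[of i] by (simp_all add: ceiling_le_iff one_le_ceiling)
      then have k_real: "real (k i) + 1 = of_int \<lceil>n * (p $ i + 1/2)\<rceil>" for i
        by (simp add: k_def)
      have "k i < n" for i using ceil[of i] n_pos by (simp add: k_def nat_less_iff)
      then have "k \<in> K" by (auto simp: K_def)
      have "\<bar>(c k - p) $ i\<bar> \<le> 1 / n" for i
      proof -
        have "(c k - p) $ i = (of_int \<lceil>n * (p $ i + 1/2)\<rceil> - n * (p $ i + 1/2)) / n"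
          using n_pos k_real[of i] by (simp add: c_def field_simps)
        moreover have "\<bar>of_int \<lceil>n * (p $ i + 1/2)\<rceil> - n * (p $ i + 1/2)\<bar> \<le> 1" by linarith
        ultimately show ?thesis using n_pos by (simp add: abs_divide divide_right_mono)
      qed
      then have "(\<Sum>i\<in>UNIV. \<bar>(c k - p) $ i\<bar>) \<le> (\<Sum>i\<in>(UNIV :: 'n set). 1 / n)"
        by (rule sum_mono)
      then have "norm (c k - p) \<le> (\<Sum>i\<in>(UNIV :: 'n set). 1 / n)"
        by (rule order_trans[OF norm_le_l1_cart])
      also have "\<dots> \<le> \<epsilon>" using side by (simp add: d_def)
      finally show ?thesis using \<open>k \<in> K\<close> by blast
    qed
    have "real (card (c ` K)) \<le> real n ^ CARD('n)"
      using card_image_le[OF finK, of c] cardK by (metis of_nat_le_iff of_nat_power)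
    also have "\<dots> \<le> (2 * d / \<epsilon>) ^ CARD('n)" by (rule power_mono[OF n_le]) simp
    finally show "real (card (c ` K)) \<le> (2 * real CARD('n) / \<epsilon>) ^ CARD('n)" by (simp add: d_def)
  qed
qed

lemma convex_torus: "convex (torus :: (real ^ 'n) set)"
proof -
  have "convex {x :: real ^ 'n. \<forall>i. x $ i \<in> {- (1/2)<..1/2}}"
    by (rule convex_box_cart) (simp only: Collect_mem_eq convex_real_interval)
  then show ?thesis by (simp add: torus_def)
qed

section \<open>Moments of Poisson counts\<close>

lemma nn_integral_fibres:
  assumes I: "I \<in> measurable M (count_space S)" and S: "countable S"
    and f[measurable]: "f \<in> borel_measurable M"
  shows "(\<integral>\<^sup>+\<omega>. f \<omega> \<partial>M) = (\<integral>\<^sup>+a. (\<integral>\<^sup>+\<omega>. f \<omega> * indicator {a} (I \<omega>) \<partial>M) \<partial>count_space S)"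
proof -
  have "(\<integral>\<^sup>+\<omega>. f \<omega> \<partial>M) = (\<integral>\<^sup>+\<omega>. (\<integral>\<^sup>+a. f \<omega> * indicator {a} (I \<omega>) \<partial>count_space S) \<partial>M)"
  proof (rule nn_integral_cong)
    fix \<omega> assume "\<omega> \<in> space M"
    then have "I \<omega> \<in> S" using measurable_space[OF I] by simp
    then have "(\<integral>\<^sup>+a. f \<omega> * indicator {a} (I \<omega>) \<partial>count_space S)
        = (\<integral>\<^sup>+a. f \<omega> * indicator {I \<omega>} a \<partial>count_space S)"
      by (intro nn_integral_cong) (auto simp: indicator_def)
    also have "\<dots> = f \<omega>" using \<open>I \<omega> \<in> S\<close> by (subst nn_integral_cmult) auto
    finally show "f \<omega> = (\<integral>\<^sup>+a. f \<omega> * indicator {a} (I \<omega>) \<partial>count_space S)" by simp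
  qed
  also have "\<dots> = (\<integral>\<^sup>+a. (\<integral>\<^sup>+\<omega>. f \<omega> * indicator {a} (I \<omega>) \<partial>M) \<partial>count_space S)"
    using measurable_compose[OF I, of "indicator {_}" borel]
    by (intro nn_integral_count_space_nn_integral[OF S] borel_measurable_times_ennreal f) simp
  finally show ?thesis .
qed

text \<open>
  Inequalities between expectations are proved on the events where some countably-valued random
  variable \<open>I\<close> (a random index set, below) is constant. On each of them the combinatorial structure is
  fixed and only the edges are random.
\<close>

lemma nn_integral_mono_fibres:
  assumes I: "I \<in> measurable M (count_space S)" and S: "countable S"
    and f: "f \<in> borel_measurable M" and g: "g \<in> borel_measurable M"
    and le: "\<And>a. a \<in> S \<Longrightarrow>
      (\<integral>\<^sup>+\<omega>. f \<omega> * indicator {a} (I \<omega>) \<partial>M) \<le> (\<integral>\<^sup>+\<omega>. g \<omega> * indicator {a} (I \<omega>) \<partial>M)"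
  shows "(\<integral>\<^sup>+\<omega>. f \<omega> \<partial>M) \<le> (\<integral>\<^sup>+\<omega>. g \<omega> \<partial>M)"
  unfolding nn_integral_fibres[OF I S f] nn_integral_fibres[OF I S g]
  by (rule nn_integral_mono) (simp add: le)

context torus_poisson_process
begin

definition point_count :: "(real ^ 'n) set \<Rightarrow> 'w \<Rightarrow> nat" where
  "point_count A \<omega> = card (point_set N X \<omega> \<inter> A)"

lemma point_count_measurable:
  assumes "A \<in> sets borel" "A \<subseteq> torus"
  shows "point_count A \<in> measurable M (count_space UNIV)"
proof -
  have "indep_vars (\<lambda>_. count_space UNIV) (\<lambda>i \<omega>. card (point_set N X \<omega> \<inter> A)) {..<1 :: nat}"
    by (rule count_indep[where A = "\<lambda>_. A"])
      (use assms in \<open>auto simp: disjoint_family_on_def\<close>)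
  then have "(\<lambda>\<omega>. card (point_set N X \<omega> \<inter> A)) \<in> measurable M (count_space UNIV)"
    unfolding indep_vars_def by simp
  then show ?thesis unfolding point_count_def .
qed

lemma nn_integral_point_count:
  assumes A: "A \<in> sets borel" "A \<subseteq> torus"
    and l: "l = s * measure lborel A"
  shows "(\<integral>\<^sup>+\<omega>. g (point_count A \<omega>) \<partial>M) = (\<Sum>k. g k * ennreal (l ^ k / fact k * exp (- l)))"
proof -
  note [measurable] = point_count_measurable[OF A]
  have "(\<integral>\<^sup>+\<omega>. g (point_count A \<omega>) \<partial>M)
      = (\<integral>\<^sup>+k. (\<integral>\<^sup>+\<omega>. g (point_count A \<omega>) * indicator {k} (point_count A \<omega>) \<partial>M) \<partial>count_space UNIV)"
    by (rule nn_integral_fibres) measurable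
  also have "\<dots> = (\<integral>\<^sup>+k. g k * ennreal (l ^ k / fact k * exp (- l)) \<partial>count_space UNIV)"
  proof (rule nn_integral_cong)
    fix k :: nat
    let ?B = "{\<omega> \<in> space M. point_count A \<omega> = k}"
    have "(\<integral>\<^sup>+\<omega>. g (point_count A \<omega>) * indicator {k} (point_count A \<omega>) \<partial>M) = (\<integral>\<^sup>+\<omega>. g k * indicator ?B \<omega> \<partial>M)"
      by (rule nn_integral_cong) (auto simp: indicator_def)
    also have "\<dots> = g k * emeasure M ?B" by (rule nn_integral_cmult_indicator) measurable
    also have "emeasure M ?B = ennreal (l ^ k / fact k * exp (- l))"
      unfolding emeasure_eq_measure using count_poisson[OF A, of k] by (simp add: l point_count_def)
    finally show "(\<integral>\<^sup>+\<omega>. g (point_count A \<omega>) * indicator {k} (point_count A \<omega>) \<partial>M)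
        = g k * ennreal (l ^ k / fact k * exp (- l))" .
  qed
  also have "\<dots> = (\<Sum>k. g k * ennreal (l ^ k / fact k * exp (- l)))"
    by (rule nn_integral_count_space_nat)
  finally show ?thesis .
qed

lemma poisson_pgf:
  assumes A: "A \<in> sets borel" "A \<subseteq> torus"
    and l: "l = s * measure lborel A" and "0 \<le> l" "0 \<le> z"
  shows "(\<integral>\<^sup>+\<omega>. ennreal (z ^ point_count A \<omega>) \<partial>M) = ennreal (exp (- l * (1 - z)))"
proof -
  have "(\<lambda>k. exp (- l) * ((z * l) ^ k /\<^sub>R fact k)) sums (exp (- l) * exp (z * l))"
    by (rule sums_mult, rule exp_converges)
  moreover have "exp (- l) * exp (z * l) = exp (- l * (1 - z))"
    unfolding exp_add[symmetric] by (simp add: algebra_simps)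
  ultimately have "(\<lambda>k. z ^ k * (l ^ k / fact k * exp (- l))) sums exp (- l * (1 - z))"
    by (simp add: power_mult_distrib divide_inverse mult_ac)
  then have "(\<Sum>k. ennreal (z ^ k * (l ^ k / fact k * exp (- l)))) = ennreal (exp (- l * (1 - z)))"
    by (rule suminf_ennreal_eq[rotated]) (use assms in simp)
  moreover have "ennreal (z ^ k * (l ^ k / fact k * exp (- l)))
      = ennreal (z ^ k) * ennreal (l ^ k / fact k * exp (- l))" for k
    by (rule ennreal_mult) (use assms in simp_all)
  ultimately show ?thesis
    by (simp only: nn_integral_point_count[OF A l, of "\<lambda>k. ennreal (z ^ k)"])
qed

text \<open>
  By differentiation of the generating function in \<open>z\<close>. It bounds the expected number of points of a
  region that fail to connect to the remaining points of the same region, when each connection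
  fails with probability \<open>z\<close>.
\<close>

lemma poisson_pgf_deriv:
  assumes A: "A \<in> sets borel" "A \<subseteq> torus"
    and l: "l = s * measure lborel A" and "0 \<le> l" "0 \<le> z"
  shows "(\<integral>\<^sup>+\<omega>. ennreal (real (point_count A \<omega>) * z ^ (point_count A \<omega> - 1)) \<partial>M)
    = ennreal (l * exp (- l * (1 - z)))"
proof -
  have "(\<lambda>k. l * exp (- l) * ((z * l) ^ k /\<^sub>R fact k)) sums (l * exp (- l) * exp (z * l))"
    by (rule sums_mult, rule exp_converges)
  moreover have "l * exp (- l) * exp (z * l) = l * exp (- l * (1 - z))"
    unfolding mult.assoc exp_add[symmetric] by (simp add: algebra_simps)
  moreover have "l * exp (- l) * ((z * l) ^ k /\<^sub>R fact k)
      = real (Suc k) * z ^ (Suc k - 1) * (l ^ Suc k / fact (Suc k) * exp (- l))" for k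
    by (simp add: power_mult_distrib real_scaleR_def inverse_eq_divide del: of_nat_Suc)
  ultimately have "(\<lambda>k. real (Suc k) * z ^ (Suc k - 1) * (l ^ Suc k / fact (Suc k) * exp (- l)))
      sums (l * exp (- l * (1 - z)))" by simp
  then have "(\<lambda>k. real k * z ^ (k - 1) * (l ^ k / fact k * exp (- l))) sums (l * exp (- l * (1 - z)))"
    by (subst (asm) sums_Suc_iff) simp
  then have "(\<Sum>k. ennreal (real k * z ^ (k - 1) * (l ^ k / fact k * exp (- l))))
      = ennreal (l * exp (- l * (1 - z)))"
    by (rule suminf_ennreal_eq[rotated]) (use assms in simp)
  moreover have "ennreal (real k * z ^ (k - 1) * (l ^ k / fact k * exp (- l)))
      = ennreal (real k * z ^ (k - 1)) * ennreal (l ^ k / fact k * exp (- l))" for k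
    by (rule ennreal_mult) (use assms in simp_all)
  ultimately show ?thesis
    by (simp only: nn_integral_point_count[OF A l, of "\<lambda>k. ennreal (real k * z ^ (k - 1))"])
qed

definition indices :: "(real ^ 'n) set \<Rightarrow> 'w \<Rightarrow> nat set" where
  "indices A \<omega> = {i. i < N \<omega> \<and> X i \<omega> \<in> A}"

lemma finite_indices: "finite (indices A \<omega>)"
  by (simp add: indices_def)

lemma card_indices:
  assumes "\<omega> \<in> space M"
  shows "card (indices A \<omega>) = point_count A \<omega>"
proof -
  have "point_set N X \<omega> \<inter> A = (\<lambda>i. X i \<omega>) ` indices A \<omega>"
    by (auto simp: point_set_def indices_def)
  moreover have "inj_on (\<lambda>i. X i \<omega>) (indices A \<omega>)"
    by (rule inj_on_subset[OF points_distinct[OF assms]]) (auto simp: indices_def)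
  ultimately show ?thesis unfolding point_count_def by (metis card_image)
qed

lemma indices_measurable:
  assumes N: "N \<in> measurable F (count_space UNIV)" and X: "\<And>i. X i \<in> borel_measurable F"
    and A[measurable]: "A \<in> sets borel"
  shows "indices A \<in> measurable F (count_space (Collect finite))"
  unfolding measurable_count_space_eq_countable[OF countable_Collect_finite]
proof (intro conjI ballI)
  show "indices A \<in> space F \<rightarrow> Collect finite" by (simp add: finite_indices)
  fix I :: "nat set" 
  note N[measurable] X[measurable]
  have "Measurable.pred F (\<lambda>\<omega>. \<forall>i. i \<in> I \<longleftrightarrow> i < N \<omega> \<and> X i \<omega> \<in> A)" by measurable
  moreover have "indices A -` {I} \<inter> space F = {\<omega> \<in> space F. \<forall>i. i \<in> I \<longleftrightarrow> i < N \<omega> \<and> X i \<omega> \<in> A}"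
    unfolding indices_def vimage_def set_eq_iff mem_Collect_eq Int_iff singleton_iff by blast
  ultimately show "indices A -` {I} \<inter> space F \<in> sets F" by (simp add: pred_def)
qed

end

section \<open>Edges given points and weights\<close>

lemma torus_dist_measurable:
  assumes [measurable]: "f \<in> borel_measurable K" "g \<in> borel_measurable K"
  shows "(\<lambda>\<omega>. torus_dist (f \<omega>) (g \<omega> :: real ^ 'n)) \<in> borel_measurable K"
  unfolding borel_measurable_iff_less
proof
  fix a :: real
  have "{\<omega> \<in> space K. torus_dist (f \<omega>) (g \<omega>) < a}
      = (\<Union>z\<in>lattice. {\<omega> \<in> space K. norm (f \<omega> - g \<omega> - z) < a})"
    unfolding torus_dist_less_iff by blast
  also have "\<dots> \<in> sets K"
    by (rule sets.countable_UN''[OF countable_lattice]) measurable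
  finally show "{\<omega> \<in> space K. torus_dist (f \<omega>) (g \<omega>) < a} \<in> sets K" .
qed

lemma connection_prob_in_unit_interval:
  assumes "0 \<le> \<eta>" "1 \<le> v" "1 \<le> w"
  shows "0 \<le> connection_prob \<eta> \<alpha> r x v y w" "connection_prob \<eta> \<alpha> r x v y w \<le> 1"
  using assms by (simp_all add: connection_prob_def)

text \<open>
  Strict positivity of the distance matters: for distance 0 the quotient in the connection
  probability is \<open>\<eta> v w / 0 = 0\<close>, and so is the probability.
\<close>

lemma connection_prob_ge:
  assumes pos: "0 < \<eta>" "0 < \<alpha>" "0 < r" "0 < a" and w: "1 \<le> v" "1 \<le> w"
    and dist: "0 < torus_dist x y" "torus_dist x y \<le> a * r"
  shows "1 - exp (- \<eta> * a powr - \<alpha>) \<le> connection_prob \<eta> \<alpha> r x v y w"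
proof -
  have "torus_dist x y / r \<le> a" using pos dist by (simp add: pos_divide_le_eq)
  then have le: "(torus_dist x y / r) powr \<alpha> \<le> a powr \<alpha>"
    using pos dist by (intro powr_mono2) auto
  have "1 * 1 \<le> v * w" using w by (intro mult_mono) auto
  then have "\<eta> * 1 \<le> \<eta> * (v * w)" using pos by (intro mult_left_mono) auto
  then have "\<eta> / a powr \<alpha> \<le> \<eta> * v * w / (torus_dist x y / r) powr \<alpha>"
    using le pos dist by (intro frac_le) (auto simp: mult.assoc)
  then show ?thesis by (simp add: connection_prob_def powr_minus divide_inverse)
qed

lemma prod_unit_interval:
  assumes "\<And>e. e \<in> J \<Longrightarrow> 0 \<le> f e \<and> f e \<le> (1 :: real)"
  shows "0 \<le> prod f J \<and> prod f J \<le> 1"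
  using assms by (auto intro: prod_nonneg prod_le_1)

lemma mult_unit_interval:
  "0 \<le> x \<and> x \<le> 1 \<Longrightarrow> 0 \<le> y \<and> y \<le> 1 \<Longrightarrow> 0 \<le> x * y \<and> x * y \<le> (1 :: real)"
  by (simp add: mult_le_one)

lemma norm_indicator_mult_le_one:
  "0 \<le> x \<and> x \<le> 1 \<Longrightarrow> norm (indicator A \<omega> * x :: real) \<le> 1"
  by (simp add: indicator_def)

context weighted_random_graph
begin

abbreviation PW :: "'w measure" where
  "PW \<equiv> points_weights_algebra M N X W"

definition edge_pairs :: "'w \<Rightarrow> (nat \<times> nat) set" where
  "edge_pairs \<omega> = {(i, j). i < j \<and> j < N \<omega> \<and> {X i \<omega>, X j \<omega>} \<in> E \<omega>}"

definition edge_prob :: "nat \<times> nat \<Rightarrow> 'w \<Rightarrow> real" where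
  "edge_prob e \<omega> = connection_prob \<eta> \<alpha> r
     (X (fst e) \<omega>) (W (fst e) \<omega>) (X (snd e) \<omega>) (W (snd e) \<omega>)"

lemma weight_measurable: "W i \<in> borel_measurable M"
  using weight_indep unfolding indep_vars_def by simp

lemma weights_ge_one: "AE \<omega> in M. \<forall>i. 1 \<le> W i \<omega>"
proof -
  have "AE \<omega> in M. 1 \<le> W i \<omega>" for i
  proof -
    have "AE w in distr M borel (W i). 1 \<le> w" using weight_distr[of i] by (simp add: weight_law_def)
    then show ?thesis by (subst (asm) AE_distr_iff) (auto simp: weight_measurable)
  qed
  then show ?thesis by (simp add: AE_all_countable)
qed

lemma space_PW [simp]: "space PW = space M"
  by (simp add: points_weights_algebra_def)

lemma points_weights_measurable:
  "(\<lambda>\<omega>. (N \<omega>, (\<lambda>i. X i \<omega>), (\<lambda>i. W i \<omega>)))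
    \<in> measurable M (count_space UNIV \<Otimes>\<^sub>M PiM UNIV (\<lambda>_. borel) \<Otimes>\<^sub>M PiM UNIV (\<lambda>_. borel))"
  by (intro measurable_Pair measurable_PiM_single' number_measurable point_measurable
      weight_measurable) auto

lemma PW_data_measurable:
  "(\<lambda>\<omega>. (N \<omega>, (\<lambda>i. X i \<omega>), (\<lambda>i. W i \<omega>)))
    \<in> measurable PW (count_space UNIV \<Otimes>\<^sub>M PiM UNIV (\<lambda>_. borel) \<Otimes>\<^sub>M PiM UNIV (\<lambda>_. borel))"
  unfolding points_weights_algebra_def
  by (rule measurable_vimage_algebra1) (auto simp: space_pair_measure space_PiM)

lemma N_PW: "N \<in> measurable PW (count_space UNIV)"
  using measurable_compose[OF PW_data_measurable measurable_fst] by simp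

lemma X_PW: "X i \<in> borel_measurable PW"
  using measurable_compose[OF measurable_compose[OF measurable_compose[OF PW_data_measurable
    measurable_snd] measurable_fst] measurable_component_singleton[of i]] by simp

lemma subalgebra_PW: "subalgebra M PW"
  unfolding subalgebra_def space_PW
  unfolding points_weights_algebra_def
  using sets_image_in_sets[OF refl points_weights_measurable] by simp

lemma edge_prob_measurable: "edge_prob e \<in> borel_measurable M"
proof -
  note [measurable] = point_measurable weight_measurable
  have [measurable]: "(\<lambda>\<omega>. torus_dist (X i \<omega>) (X j \<omega>)) \<in> borel_measurable M" for i j
    by (rule torus_dist_measurable) measurable
  show ?thesis unfolding edge_prob_def connection_prob_def by measurable
qed

lemma edge_pair_measurable: "{\<omega> \<in> space M. e \<in> edge_pairs \<omega>} \<in> sets M"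
proof (cases "fst e < snd e")
  case True
  then have "{\<omega> \<in> space M. e \<in> edge_pairs \<omega>}
      = {\<omega> \<in> space M. snd e < N \<omega> \<and> {X (fst e) \<omega>, X (snd e) \<omega>} \<in> E \<omega>}"
    by (cases e) (auto simp: edge_pairs_def)
  then show ?thesis using edge_event[OF True] by simp
next
  case False
  then have "{\<omega> \<in> space M. e \<in> edge_pairs \<omega>} = {}" by (cases e) (auto simp: edge_pairs_def)
  then show ?thesis by (simp only: sets.empty_sets)
qed

lemma edge_pair_indicator_measurable:
  "(\<lambda>\<omega>. of_bool (e \<in> edge_pairs \<omega>) :: real) \<in> borel_measurable M"
proof -
  have "(indicator {\<omega> \<in> space M. e \<in> edge_pairs \<omega>} :: 'w \<Rightarrow> real) \<in> borel_measurable M"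
    using edge_pair_measurable by simp
  then show ?thesis
    by (rule measurable_cong[THEN iffD1, rotated]) (simp add: indicator_def)
qed

lemma edge_prob_bounds:
  assumes "0 \<le> \<eta>"
  shows "AE \<omega> in M. \<forall>e. 0 \<le> edge_prob e \<omega> \<and> edge_prob e \<omega> \<le> 1"
  using weights_ge_one
  by eventually_elim (simp add: edge_prob_def connection_prob_in_unit_interval assms)

lemma expectation_edges_present:
  assumes J: "finite J" "J \<subseteq> {(i, j). i < j}"
    and A: "A \<in> sets PW" "\<And>\<omega> e. \<omega> \<in> A \<Longrightarrow> e \<in> J \<Longrightarrow> snd e < N \<omega>"
  shows "(\<integral>\<omega>. indicator A \<omega> * (\<Prod>e\<in>J. of_bool (e \<in> edge_pairs \<omega>)) \<partial>M)
    = (\<integral>\<omega>. indicator A \<omega> * (\<Prod>e\<in>J. edge_prob e \<omega>) \<partial>M)"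
proof -
  interpret PW: finite_measure_subalgebra M PW
    by (unfold_locales) (rule subalgebra_PW)
  define B where "B = {\<omega> \<in> space M. \<forall>(i, j)\<in>J. j < N \<omega> \<and> {X i \<omega>, X j \<omega>} \<in> E \<omega>}"
  have A_M: "A \<in> sets M" using A(1) subalgebra_PW by (auto simp: subalgebra_def)
  have B_eq: "B = {\<omega> \<in> space M. \<forall>e\<in>J. e \<in> edge_pairs \<omega>}"
    using J(2) by (auto simp: B_def edge_pairs_def)
  have B: "B \<in> sets M"
    unfolding B_eq by (rule sets.sets_Collect_finite_All[OF edge_pair_measurable J(1)])
  have prod_B: "(\<Prod>e\<in>J. of_bool (e \<in> edge_pairs \<omega>)) = (indicator B \<omega> :: real)"
    if "\<omega> \<in> space M" for \<omega>
    using that J(1) by (auto simp: B_eq indicator_def prod_zero_iff)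
  have "(\<integral>\<omega>. indicator A \<omega> * (\<Prod>e\<in>J. of_bool (e \<in> edge_pairs \<omega>)) \<partial>M)
      = (\<integral>\<omega>. indicator A \<omega> * (indicator B \<omega> :: real) \<partial>M)"
    by (rule Bochner_Integration.integral_cong) (simp_all add: prod_B)
  also have "\<dots> = (\<integral>\<omega>. indicator A \<omega> * real_cond_exp M PW (indicator B) \<omega> \<partial>M)"
  proof (rule PW.real_cond_exp_intg(2)[symmetric])
    show "integrable M (\<lambda>\<omega>. indicator A \<omega> * indicator B \<omega> :: real)"
      using A_M B by (intro integrable_const_bound[of _ 1]) (auto simp: indicator_def)
    show "indicator A \<in> borel_measurable PW" using A(1) by simp
    show "indicator B \<in> borel_measurable M" using B by simp
  qed
  also have "\<dots> = (\<integral>\<omega>. indicator A \<omega> * (\<Prod>e\<in>J. edge_prob e \<omega>) \<partial>M)"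
  proof (rule integral_cong_AE)
    have "AE \<omega> in M. (\<forall>(i, j)\<in>J. j < N \<omega>) \<longrightarrow>
        real_cond_exp M PW (indicator B) \<omega> = (\<Prod>e\<in>J. edge_prob e \<omega>)"
      using edges_cond_law[OF J] by (simp add: B_def edge_prob_def case_prod_unfold)
    then show "AE \<omega> in M. indicator A \<omega> * real_cond_exp M PW (indicator B) \<omega>
        = indicator A \<omega> * (\<Prod>e\<in>J. edge_prob e \<omega>)"
      by eventually_elim (use A(2) in \<open>auto simp: indicator_def case_prod_unfold\<close>)
  qed (use A_M edge_prob_measurable in measurable)
  finally show ?thesis .
qed

text \<open>
  The prescribed conditional law speaks of edges being present. Expanding
  the factors \<open>1 - c \<cdot> 1\<^sub>e\<close> one at a time extends it to products that penalise each edge by the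
  factor \<open>1 - c\<close>: for \<open>c = 1\<close> this is the probability that no edge of \<open>J\<close> is present, and for
  \<open>c = 1 - exp (- t)\<close> it is the Laplace transform of the number of edges in \<open>J\<close>. The set \<open>K\<close>
  collects the factors that the expansion has already converted, so that the induction goes through.
\<close>

lemma expectation_edges_product:
  assumes \<eta>: "0 \<le> \<eta>" and c: "0 \<le> c" "c \<le> 1"
    and J: "finite J" and K: "finite K" "J \<inter> K = {}" "J \<union> K \<subseteq> {(i, j). i < j}"
    and A: "A \<in> sets PW" "\<And>\<omega> e. \<omega> \<in> A \<Longrightarrow> e \<in> J \<union> K \<Longrightarrow> snd e < N \<omega>"
  shows "(\<integral>\<omega>. indicator A \<omega> * ((\<Prod>e\<in>J. 1 - c * of_bool (e \<in> edge_pairs \<omega>))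
        * (\<Prod>e\<in>K. of_bool (e \<in> edge_pairs \<omega>))) \<partial>M)
    = (\<integral>\<omega>. indicator A \<omega> * ((\<Prod>e\<in>J. 1 - c * edge_prob e \<omega>) * (\<Prod>e\<in>K. edge_prob e \<omega>)) \<partial>M)"
  using J K A(2)
proof (induction J arbitrary: K rule: finite_induct)
  case empty
  then show ?case using expectation_edges_present[of K A] A(1) by simp
next
  case (insert e J)
  have A_M: "A \<in> sets M" using A(1) subalgebra_PW by (auto simp: subalgebra_def)
  note [measurable] = A_M edge_prob_measurable edge_pair_indicator_measurable
  have int_edge: "integrable M (\<lambda>\<omega>. indicator A \<omega> * ((\<Prod>e\<in>J. 1 - c * of_bool (e \<in> edge_pairs \<omega>))
        * (\<Prod>e\<in>K. of_bool (e \<in> edge_pairs \<omega>))) :: real)" for J K :: "(nat \<times> nat) set"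
  proof (rule integrable_const_bound[of _ 1])
    show "AE \<omega> in M. norm (indicator A \<omega> * ((\<Prod>e\<in>J. 1 - c * of_bool (e \<in> edge_pairs \<omega>))
        * (\<Prod>e\<in>K. of_bool (e \<in> edge_pairs \<omega>))) :: real) \<le> 1"
      using c by (intro AE_I2 norm_indicator_mult_le_one mult_unit_interval prod_unit_interval) auto
  qed measurable
  have int_prob: "integrable M (\<lambda>\<omega>. indicator A \<omega> * ((\<Prod>e\<in>J. 1 - c * edge_prob e \<omega>)
        * (\<Prod>e\<in>K. edge_prob e \<omega>)) :: real)" for J K :: "(nat \<times> nat) set"
  proof (rule integrable_const_bound[of _ 1])
    show "AE \<omega> in M. norm (indicator A \<omega> * ((\<Prod>e\<in>J. 1 - c * edge_prob e \<omega>)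
        * (\<Prod>e\<in>K. edge_prob e \<omega>)) :: real) \<le> 1"
      using edge_prob_bounds[OF \<eta>]
    proof eventually_elim
      case (elim \<omega>)
      have "0 \<le> 1 - c * edge_prob e \<omega>" "1 - c * edge_prob e \<omega> \<le> 1" for e
        using mult_unit_interval[of c "edge_prob e \<omega>"] elim[rule_format, of e] c by simp_all
      then show ?case using elim
        by (intro norm_indicator_mult_le_one mult_unit_interval prod_unit_interval) auto
    qed
  qed measurable
  have e: "e \<notin> J" "e \<notin> K" using insert by auto
  let ?b = "\<lambda>e \<omega>. of_bool (e \<in> edge_pairs \<omega>) :: real"
  \<comment> \<open>Splitting off the factor of the new edge: the second summand moves that edge from \<open>J\<close> to \<open>K\<close>.\<close>
  have expand: "i * ((1 - c * x) * p * q) = i * (p * q) - c * (i * (p * (x * q)))" for i x p q :: real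
    by (simp add: algebra_simps)
  have "(\<integral>\<omega>. indicator A \<omega> * ((\<Prod>e\<in>insert e J. 1 - c * ?b e \<omega>) * (\<Prod>e\<in>K. ?b e \<omega>)) \<partial>M)
      = (\<integral>\<omega>. indicator A \<omega> * ((\<Prod>e\<in>J. 1 - c * ?b e \<omega>) * (\<Prod>e\<in>K. ?b e \<omega>))
         - c * (indicator A \<omega> * ((\<Prod>e\<in>J. 1 - c * ?b e \<omega>) * (\<Prod>e\<in>insert e K. ?b e \<omega>))) \<partial>M)"
    by (intro Bochner_Integration.integral_cong refl)
      (simp only: prod.insert[OF insert(1) e(1)] prod.insert[OF \<open>finite K\<close> e(2)] expand)
  also have "\<dots> = (\<integral>\<omega>. indicator A \<omega> * ((\<Prod>e\<in>J. 1 - c * ?b e \<omega>) * (\<Prod>e\<in>K. ?b e \<omega>)) \<partial>M)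
      - c * (\<integral>\<omega>. indicator A \<omega> * ((\<Prod>e\<in>J. 1 - c * ?b e \<omega>) * (\<Prod>e\<in>insert e K. ?b e \<omega>)) \<partial>M)"
    by (simp only: Bochner_Integration.integral_diff[OF int_edge integrable_mult_right[OF int_edge]]
        integral_mult_right_zero)
  also have "(\<integral>\<omega>. indicator A \<omega> * ((\<Prod>e\<in>J. 1 - c * ?b e \<omega>) * (\<Prod>e\<in>K. ?b e \<omega>)) \<partial>M)
      = (\<integral>\<omega>. indicator A \<omega> * ((\<Prod>e\<in>J. 1 - c * edge_prob e \<omega>) * (\<Prod>e\<in>K. edge_prob e \<omega>)) \<partial>M)"
    by (rule insert.IH) (use insert.prems in auto)
  also have "(\<integral>\<omega>. indicator A \<omega> * ((\<Prod>e\<in>J. 1 - c * ?b e \<omega>) * (\<Prod>e\<in>insert e K. ?b e \<omega>)) \<partial>M)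
      = (\<integral>\<omega>. indicator A \<omega> * ((\<Prod>e\<in>J. 1 - c * edge_prob e \<omega>) * (\<Prod>e\<in>insert e K. edge_prob e \<omega>)) \<partial>M)"
    by (rule insert.IH) (use insert.prems e in auto)
  also have "(\<integral>\<omega>. indicator A \<omega> * ((\<Prod>e\<in>J. 1 - c * edge_prob e \<omega>) * (\<Prod>e\<in>K. edge_prob e \<omega>)) \<partial>M)
      - c * (\<integral>\<omega>. indicator A \<omega> * ((\<Prod>e\<in>J. 1 - c * edge_prob e \<omega>) * (\<Prod>e\<in>insert e K. edge_prob e \<omega>)) \<partial>M)
      = (\<integral>\<omega>. indicator A \<omega> * ((\<Prod>e\<in>J. 1 - c * edge_prob e \<omega>) * (\<Prod>e\<in>K. edge_prob e \<omega>))
         - c * (indicator A \<omega> * ((\<Prod>e\<in>J. 1 - c * edge_prob e \<omega>) * (\<Prod>e\<in>insert e K. edge_prob e \<omega>))) \<partial>M)"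
    by (simp only: Bochner_Integration.integral_diff[OF int_prob integrable_mult_right[OF int_prob]]
        integral_mult_right_zero)
  also have "\<dots> = (\<integral>\<omega>. indicator A \<omega> * ((\<Prod>e\<in>insert e J. 1 - c * edge_prob e \<omega>) * (\<Prod>e\<in>K. edge_prob e \<omega>)) \<partial>M)"
    by (intro Bochner_Integration.integral_cong refl)
      (simp only: prod.insert[OF insert(1) e(1)] prod.insert[OF \<open>finite K\<close> e(2)] expand)
  finally show ?case .
qed

lemma nn_integral_edges_product_le:
  assumes pos: "0 < \<eta>" "0 < \<alpha>" "0 < r" "0 < a" and c: "0 \<le> c" "c \<le> 1"
    and J: "finite J" "J \<subseteq> {(i, j). i < j}"
    and A: "A \<in> sets PW"
    and present: "\<And>\<omega> e. \<omega> \<in> A \<Longrightarrow> e \<in> J \<Longrightarrow> snd e < N \<omega>"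
    and close: "\<And>\<omega> e. \<omega> \<in> A \<Longrightarrow> e \<in> J \<Longrightarrow> torus_dist (X (fst e) \<omega>) (X (snd e) \<omega>) \<le> a * r"
  shows "(\<integral>\<^sup>+\<omega>. ennreal (\<Prod>e\<in>J. 1 - c * of_bool (e \<in> edge_pairs \<omega>)) * indicator A \<omega> \<partial>M)
    \<le> ennreal ((1 - c * (1 - exp (- \<eta> * a powr - \<alpha>))) ^ card J) * emeasure M A"
proof -
  define z where "z = 1 - c * (1 - exp (- \<eta> * a powr - \<alpha>))"
  have A_M: "A \<in> sets M" using A(1) subalgebra_PW by (auto simp: subalgebra_def)
  note [measurable] = A_M edge_prob_measurable edge_pair_indicator_measurable
  let ?b = "\<lambda>e \<omega>. of_bool (e \<in> edge_pairs \<omega>) :: real"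
  have z: "0 \<le> z" using pos c by (auto simp: z_def intro!: mult_le_one)
  have b_nonneg: "0 \<le> (\<Prod>e\<in>J. 1 - c * ?b e \<omega>)" for \<omega>
    using c by (auto intro!: prod_nonneg)
  have b_le: "(\<Prod>e\<in>J. 1 - c * ?b e \<omega>) \<le> 1" for \<omega>
    using c by (auto intro!: prod_le_1)
  have "(\<integral>\<^sup>+\<omega>. ennreal (\<Prod>e\<in>J. 1 - c * ?b e \<omega>) * indicator A \<omega> \<partial>M)
      = (\<integral>\<^sup>+\<omega>. ennreal (indicator A \<omega> * (\<Prod>e\<in>J. 1 - c * ?b e \<omega>)) \<partial>M)"
    by (rule nn_integral_cong) (auto simp: indicator_def)
  also have "\<dots> = ennreal (\<integral>\<omega>. indicator A \<omega> * (\<Prod>e\<in>J. 1 - c * ?b e \<omega>) \<partial>M)"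
  proof (rule nn_integral_eq_integral)
    show "integrable M (\<lambda>\<omega>. indicator A \<omega> * (\<Prod>e\<in>J. 1 - c * ?b e \<omega>))"
      using b_nonneg b_le by (intro integrable_const_bound[of _ 1] AE_I2) (auto simp: indicator_def)
  qed (use b_nonneg in auto)
  also have "(\<integral>\<omega>. indicator A \<omega> * (\<Prod>e\<in>J. 1 - c * ?b e \<omega>) \<partial>M)
      = (\<integral>\<omega>. indicator A \<omega> * (\<Prod>e\<in>J. 1 - c * edge_prob e \<omega>) \<partial>M)"
    using expectation_edges_product[of c J "{}" A] pos c J A present by simp
  also have "ennreal (\<integral>\<omega>. indicator A \<omega> * (\<Prod>e\<in>J. 1 - c * edge_prob e \<omega>) \<partial>M)
      \<le> ennreal (\<integral>\<omega>. indicator A \<omega> * z ^ card J \<partial>M)"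
  proof (intro ennreal_leI integral_mono_AE')
    show "integrable M (\<lambda>\<omega>. indicator A \<omega> * z ^ card J)"
      using A_M by (simp add: integrable_indicator_iff emeasure_eq_measure)
    have bounds: "AE \<omega> in M. \<omega> \<in> space M \<and> (\<forall>e. 0 \<le> edge_prob e \<omega> \<and> edge_prob e \<omega> \<le> 1)
        \<and> (\<forall>i. 1 \<le> W i \<omega>)"
      using edge_prob_bounds[of] weights_ge_one pos AE_space by auto
    from bounds show "AE \<omega> in M. indicator A \<omega> * (\<Prod>e\<in>J. 1 - c * edge_prob e \<omega>)
        \<le> indicator A \<omega> * z ^ card J"
    proof eventually_elim
      case (elim \<omega>)
      show ?case
      proof (cases "\<omega> \<in> A")
        case True
        have "1 - c * edge_prob e \<omega> \<le> z" if e: "e \<in> J" for e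
        proof -
          have lt: "fst e < snd e" "snd e < N \<omega>" using e J(2) present[OF True] by auto
          then have "X (fst e) \<omega> \<noteq> X (snd e) \<omega>"
            using elim inj_onD[OF points_distinct[of \<omega>], of "fst e" "snd e"] by auto
          then have "0 < torus_dist (X (fst e) \<omega>) (X (snd e) \<omega>)"
            using elim lt point_in_torus by (intro torus_dist_pos) auto
          then have "1 - exp (- \<eta> * a powr - \<alpha>) \<le> edge_prob e \<omega>"
            unfolding edge_prob_def using pos elim close[OF True e] by (intro connection_prob_ge) auto
          then show ?thesis unfolding z_def using c by (simp add: mult_left_mono)
        qed
        moreover have "0 \<le> 1 - c * edge_prob e \<omega>" for e
          using mult_unit_interval[of c "edge_prob e \<omega>"] elim c by (simp del: split_paired_All)
        ultimately have "(\<Prod>e\<in>J. 1 - c * edge_prob e \<omega>) \<le> (\<Prod>e\<in>J. z)"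
          by (intro prod_mono) auto
        then show ?thesis using True by simp
      qed simp
    qed
    from bounds show "AE \<omega> in M. 0 \<le> indicator A \<omega> * z ^ card J"
      using z by auto
  qed
  also have "(\<integral>\<omega>. indicator A \<omega> * z ^ card J \<partial>M) = z ^ card J * measure M A"
    using A_M by (simp add: mult.commute)
  finally show ?thesis using z by (simp add: z_def ennreal_mult emeasure_eq_measure)
qed

end

section \<open>Empty balls, small degrees and separated sets near a centre\<close>

definition edge_index :: "nat \<Rightarrow> nat \<Rightarrow> nat \<times> nat" where
  "edge_index i j = (min i j, max i j)"

lemma edge_index_commute: "edge_index i j = edge_index j i"
  by (simp add: edge_index_def min.commute max.commute)

lemma edge_index_eq_iff:
  "edge_index i j = edge_index k l \<longleftrightarrow> (i = k \<and> j = l) \<or> (i = l \<and> j = k)"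
  by (auto simp: edge_index_def min_def max_def split: if_splits)

definition neighbours :: "(nat \<times> nat) set \<Rightarrow> nat set \<Rightarrow> nat \<Rightarrow> nat set" where
  "neighbours G I i = {j \<in> I - {i}. edge_index i j \<in> G}"

lemma prod_neighbours:
  assumes "finite I"
  shows "(\<Prod>e\<in>edge_index i ` (I - {i}). 1 - c * of_bool (e \<in> G)) = (1 - c :: real) ^ card (neighbours G I i)"
proof -
  have "inj_on (edge_index i) (I - {i})" by (auto simp: inj_on_def edge_index_eq_iff)
  then have "(\<Prod>e\<in>edge_index i ` (I - {i}). 1 - c * of_bool (e \<in> G))
      = (\<Prod>j\<in>I - {i}. 1 - c * of_bool (edge_index i j \<in> G))"
    by (simp add: prod.reindex)
  also have "\<dots> = (\<Prod>j\<in>I - {i}. if edge_index i j \<in> G then 1 - c else 1)"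
    by (rule prod.cong) auto
  also have "\<dots> = (\<Prod>j\<in>neighbours G I i. 1 - c)"
    unfolding neighbours_def by (rule prod.inter_filter[symmetric]) (use assms in simp)
  finally show ?thesis by simp
qed

text \<open>
  The first argument is a real threshold because it will be a multiple of \<open>log s\<close>.
\<close>

definition separated_pairs :: "real \<Rightarrow> nat set \<Rightarrow> (nat set \<times> nat set) set" where
  "separated_pairs x I = {(S, T). S \<subseteq> I \<and> T \<subseteq> I \<and> S \<inter> T = {} \<and> x \<le> card S \<and> x \<le> card T}"

definition no_edge_between :: "(nat \<times> nat) set \<Rightarrow> nat set \<Rightarrow> nat set \<Rightarrow> bool" where
  "no_edge_between G S T \<longleftrightarrow> (\<forall>i\<in>S. \<forall>j\<in>T. edge_index i j \<notin> G)"

lemma finite_separated_pairs: "finite I \<Longrightarrow> finite (separated_pairs x I)"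
  by (rule finite_subset[of _ "Pow I \<times> Pow I"]) (auto simp: separated_pairs_def)

lemma card_separated_pairs_le:
  assumes "finite I"
  shows "card (separated_pairs x I) \<le> 4 ^ card I"
proof -
  have "card (separated_pairs x I) \<le> card (Pow I \<times> Pow I)"
    by (rule card_mono) (use assms in \<open>auto simp: separated_pairs_def\<close>)
  also have "\<dots> = 4 ^ card I"
    using assms by (simp add: card_cartesian_product card_Pow flip: power_mult_distrib)
  finally show ?thesis .
qed

lemma card_edge_index_image:
  assumes "S \<inter> T = {}"
  shows "card ((\<lambda>(i, j). edge_index i j) ` (S \<times> T)) = card S * card T"
proof -
  have "inj_on (\<lambda>(i, j). edge_index i j) (S \<times> T)"
    using assms by (auto simp: inj_on_def edge_index_eq_iff)
  then show ?thesis by (simp add: card_image card_cartesian_product)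
qed

lemma measurable_Pair_countable:
  assumes "f \<in> measurable K (count_space S)" "g \<in> measurable K (count_space T)"
    and "countable S" "countable T"
  shows "(\<lambda>\<omega>. (f \<omega>, g \<omega>)) \<in> measurable K (count_space (S \<times> T))"
  using measurable_Pair[OF assms(1,2)] assms(3,4) by (simp add: pair_measure_countable)

lemma sets_Collect_countable_valued:
  assumes "f \<in> measurable K (count_space S)"
  shows "{\<omega> \<in> space K. P (f \<omega>)} \<in> sets K"
proof -
  have "{\<omega> \<in> space K. P (f \<omega>)} = f -` {a \<in> S. P a} \<inter> space K"
    using measurable_space[OF assms] by auto
  then show ?thesis using measurable_sets[OF assms, of "{a \<in> S. P a}"] by simp
qed

context weighted_random_graph
begin

lemma finite_edge_pairs: "finite (edge_pairs \<omega>)"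
  by (rule finite_subset[of _ "{..<N \<omega>} \<times> {..<N \<omega>}"]) (auto simp: edge_pairs_def)

lemma edge_pairs_measurable: "edge_pairs \<in> measurable M (count_space (Collect finite))"
  unfolding measurable_count_space_eq_countable[OF countable_Collect_finite]
proof (intro conjI ballI)
  show "edge_pairs \<in> space M \<rightarrow> Collect finite" by (simp add: finite_edge_pairs)
  fix G :: "(nat \<times> nat) set"
  have edge: "Measurable.pred M (\<lambda>\<omega>. e \<in> edge_pairs \<omega>)" for e
    using edge_pair_measurable by (simp add: pred_def)
  have "Measurable.pred M (\<lambda>\<omega>. \<forall>e. e \<in> edge_pairs \<omega> \<longleftrightarrow> e \<in> G)"
    by (intro pred_intros_countable pred_intros_logic edge) simp
  moreover have "edge_pairs -` {G} \<inter> space M = {\<omega> \<in> space M. \<forall>e. e \<in> edge_pairs \<omega> \<longleftrightarrow> e \<in> G}"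
    unfolding vimage_def set_eq_iff mem_Collect_eq Int_iff singleton_iff by blast
  ultimately show "edge_pairs -` {G} \<inter> space M \<in> sets M" by (simp add: pred_def)
qed

lemma indices_PW: "A \<in> sets borel \<Longrightarrow> indices A \<in> measurable PW (count_space (Collect finite))"
  by (rule indices_measurable[OF N_PW X_PW])

lemma measurable_from_PW: "f \<in> measurable PW K \<Longrightarrow> f \<in> measurable M K"
  by (rule measurable_from_subalg[OF subalgebra_PW])

text \<open>
  A first-moment bound with random index sets. The families \<open>K\<close> and \<open>J\<close> may depend on points and
  weights through the countably-valued \<open>D\<close>; on each fibre of \<open>D\<close> they are constant, and conditional
  independence replaces each edge factor by at most \<open>1 - c p\<close>, where \<open>p\<close> is the least connection
  probability at distance \<open>a r\<close> of two vertices of weight 1.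
\<close>

lemma nn_integral_sum_edges_product_le:
  fixes J :: "'a \<Rightarrow> 'k \<Rightarrow> (nat \<times> nat) set"
  assumes pos: "0 < \<eta>" "0 < \<alpha>" "0 < r" "0 < a" and c: "0 \<le> c" "c \<le> 1"
    and D: "D \<in> measurable PW (count_space S)" "countable S"
    and fin: "\<And>d k. d \<in> S \<Longrightarrow> k \<in> K d \<Longrightarrow> finite (J d k)"
    and close: "\<And>\<omega> k e. \<omega> \<in> space M \<Longrightarrow> k \<in> K (D \<omega>) \<Longrightarrow> e \<in> J (D \<omega>) k \<Longrightarrow>
      fst e < snd e \<and> snd e < N \<omega> \<and> torus_dist (X (fst e) \<omega>) (X (snd e) \<omega>) \<le> a * r"
  shows "(\<integral>\<^sup>+\<omega>. (\<Sum>k\<in>K (D \<omega>). ennreal (\<Prod>e\<in>J (D \<omega>) k. 1 - c * of_bool (e \<in> edge_pairs \<omega>))) \<partial>M)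
    \<le> (\<integral>\<^sup>+\<omega>. (\<Sum>k\<in>K (D \<omega>).
        ennreal ((1 - c * (1 - exp (- \<eta> * a powr - \<alpha>))) ^ card (J (D \<omega>) k))) \<partial>M)"
proof (rule nn_integral_mono_fibres[OF measurable_from_PW[OF D(1)] D(2)])
  let ?z = "1 - c * (1 - exp (- \<eta> * a powr - \<alpha>))"
  note D_M = measurable_from_PW[OF D(1)]
  have DG: "(\<lambda>\<omega>. (D \<omega>, edge_pairs \<omega>)) \<in> measurable M (count_space (S \<times> Collect finite))"
    by (rule measurable_Pair_countable[OF D_M edge_pairs_measurable D(2) countable_Collect_finite])
  show "(\<lambda>\<omega>. \<Sum>k\<in>K (D \<omega>). ennreal (\<Prod>e\<in>J (D \<omega>) k. 1 - c * of_bool (e \<in> edge_pairs \<omega>)))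
      \<in> borel_measurable M"
    using measurable_compose[OF DG, of "\<lambda>(d, G). \<Sum>k\<in>K d. ennreal (\<Prod>e\<in>J d k. 1 - c * of_bool (e \<in> G))" borel]
    by simp
  show "(\<lambda>\<omega>. \<Sum>k\<in>K (D \<omega>). ennreal (?z ^ card (J (D \<omega>) k))) \<in> borel_measurable M"
    using measurable_compose[OF D_M, of "\<lambda>d. \<Sum>k\<in>K d. ennreal (?z ^ card (J d k))" borel] by simp
  fix d assume d: "d \<in> S"
  define A where "A = {\<omega> \<in> space M. D \<omega> = d}"
  have A: "A \<in> sets PW"
    using sets_Collect_countable_valued[OF D(1), of "\<lambda>x. x = d"] by (simp add: A_def)
  have A_M: "A \<in> sets M" using A subalgebra_PW by (auto simp: subalgebra_def)
  note [measurable] = A_M edge_pair_indicator_measurable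
  have "(\<integral>\<^sup>+\<omega>. (\<Sum>k\<in>K (D \<omega>). ennreal (\<Prod>e\<in>J (D \<omega>) k. 1 - c * of_bool (e \<in> edge_pairs \<omega>)))
        * indicator {d} (D \<omega>) \<partial>M)
      = (\<integral>\<^sup>+\<omega>. (\<Sum>k\<in>K d. ennreal (\<Prod>e\<in>J d k. 1 - c * of_bool (e \<in> edge_pairs \<omega>)) * indicator A \<omega>) \<partial>M)"
    by (rule nn_integral_cong) (auto simp: A_def indicator_def)
  also have "\<dots> = (\<Sum>k\<in>K d. \<integral>\<^sup>+\<omega>. ennreal (\<Prod>e\<in>J d k. 1 - c * of_bool (e \<in> edge_pairs \<omega>)) * indicator A \<omega> \<partial>M)"
    by (rule nn_integral_sum) measurable
  also have "\<dots> \<le> (\<Sum>k\<in>K d. ennreal (?z ^ card (J d k)) * emeasure M A)"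
  proof (rule sum_mono)
    fix k assume k: "k \<in> K d"
    show "(\<integral>\<^sup>+\<omega>. ennreal (\<Prod>e\<in>J d k. 1 - c * of_bool (e \<in> edge_pairs \<omega>)) * indicator A \<omega> \<partial>M)
        \<le> ennreal (?z ^ card (J d k)) * emeasure M A"
    proof (cases "A = {}")
      case False
      then obtain \<omega>0 where "\<omega>0 \<in> space M" "D \<omega>0 = d" by (auto simp: A_def)
      then have "J d k \<subseteq> {(i, j). i < j}" using close[of \<omega>0 k] k by auto
      then show ?thesis using pos c A k close
        by (intro nn_integral_edges_product_le fin[OF d k]) (auto simp: A_def)
    qed simp
  qed
  also have "\<dots> = (\<integral>\<^sup>+\<omega>. (\<Sum>k\<in>K d. ennreal (?z ^ card (J d k))) * indicator A \<omega> \<partial>M)"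
    using A_M by (subst nn_integral_cmult_indicator) (simp_all add: sum_distrib_right)
  also have "\<dots> = (\<integral>\<^sup>+\<omega>. (\<Sum>k\<in>K (D \<omega>). ennreal (?z ^ card (J (D \<omega>) k))) * indicator {d} (D \<omega>) \<partial>M)"
    by (rule nn_integral_cong) (auto simp: A_def indicator_def)
  finally show "(\<integral>\<^sup>+\<omega>. (\<Sum>k\<in>K (D \<omega>). ennreal (\<Prod>e\<in>J (D \<omega>) k. 1 - c * of_bool (e \<in> edge_pairs \<omega>)))
        * indicator {d} (D \<omega>) \<partial>M)
      \<le> (\<integral>\<^sup>+\<omega>. (\<Sum>k\<in>K (D \<omega>). ennreal (?z ^ card (J (D \<omega>) k))) * indicator {d} (D \<omega>) \<partial>M)" .
qed

definition empty_event :: "(real ^ 'n) set \<Rightarrow> 'w set" where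
  "empty_event U = {\<omega> \<in> space M. indices U \<omega> = {}}"

definition few_neighbours_event :: "real \<Rightarrow> (real ^ 'n) set \<Rightarrow> (real ^ 'n) set \<Rightarrow> 'w set" where
  "few_neighbours_event x A U = {\<omega> \<in> space M.
     \<exists>i\<in>indices A \<omega>. real (card (neighbours (edge_pairs \<omega>) (indices U \<omega>) i)) < x}"

definition separated_event :: "real \<Rightarrow> (real ^ 'n) set \<Rightarrow> 'w set" where
  "separated_event x V = {\<omega> \<in> space M.
     \<exists>(S, T)\<in>separated_pairs x (indices V \<omega>). no_edge_between (edge_pairs \<omega>) S T}"

lemma empty_event_measurable: "U \<in> sets borel \<Longrightarrow> empty_event U \<in> sets M"
  unfolding empty_event_def
  by (rule sets_Collect_countable_valued[OF measurable_from_PW[OF indices_PW]])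

lemma few_neighbours_event_measurable:
  assumes "A \<in> sets borel" "U \<in> sets borel"
  shows "few_neighbours_event x A U \<in> sets M"
proof -
  have "(\<lambda>\<omega>. ((indices A \<omega>, indices U \<omega>), edge_pairs \<omega>))
      \<in> measurable M (count_space ((Collect finite \<times> Collect finite) \<times> Collect finite))"
    by (intro measurable_Pair_countable measurable_from_PW indices_PW assms edge_pairs_measurable
        countable_Collect_finite countable_SIGMA)
  from sets_Collect_countable_valued[OF this,
      of "\<lambda>((I, K), G). \<exists>i\<in>I. real (card (neighbours G K i)) < x"]
  show ?thesis unfolding few_neighbours_event_def by simp
qed

lemma separated_event_measurable:
  assumes "V \<in> sets borel"
  shows "separated_event x V \<in> sets M"
proof -
  have "(\<lambda>\<omega>. (indices V \<omega>, edge_pairs \<omega>))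
      \<in> measurable M (count_space (Collect finite \<times> Collect finite))"
    by (intro measurable_Pair_countable measurable_from_PW indices_PW assms edge_pairs_measurable
        countable_Collect_finite)
  from sets_Collect_countable_valued[OF this,
      of "\<lambda>(I, G). \<exists>(S, T)\<in>separated_pairs x I. no_edge_between G S T"]
  show ?thesis unfolding separated_event_def by simp
qed

lemma prob_empty_event:
  assumes "U \<in> sets borel" "U \<subseteq> torus"
  shows "prob (empty_event U) = exp (- (s * measure lborel U))"
proof -
  have "empty_event U = {\<omega> \<in> space M. card (point_set N X \<omega> \<inter> U) = 0}"
    using card_indices finite_indices unfolding empty_event_def point_count_def
    by (metis card_0_eq)
  then show ?thesis using count_poisson[OF assms, of 0] by simp
qed

text \<open>
  A Chernoff bound, summed over the vertices \<open>i\<close> in \<open>A\<close>. If \<open>i\<close> has fewer than \<open>x\<close> neighbours in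
  \<open>U\<close>, then \<open>exp (t x)\<close> times the product of \<open>exp (- t)\<close> over these neighbours is at least 1; its
  conditional expectation is at most \<open>exp (t x) z\<^sup>n\<close>, with one factor
  \<open>z = 1 - (1 - exp (- t)) p\<close> for each of the \<open>n\<close> other points in \<open>U\<close>. There are at most \<open>n + 1\<close>
  choices of \<open>i\<close>, and the derivative of the Poisson generating function sums up \<open>(n + 1) z\<^sup>n\<close>.
\<close>

lemma prob_few_neighbours_event_le:
  assumes pos: "0 < \<eta>" "0 < \<alpha>" "0 < r" "0 < a" "0 \<le> t"
    and A: "A \<in> sets borel" "A \<subseteq> U" and U: "U \<in> sets borel" "U \<subseteq> torus"
    and close: "\<And>x y. x \<in> A \<Longrightarrow> y \<in> U \<Longrightarrow> torus_dist x y \<le> a * r"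
    and l: "l = s * measure lborel U" "0 \<le> l"
  shows "prob (few_neighbours_event x A U)
    \<le> exp (t * x) * (l * exp (- l * ((1 - exp (- t)) * (1 - exp (- \<eta> * a powr - \<alpha>)))))"
proof -
  define c where "c = 1 - exp (- t)"
  define z where "z = 1 - c * (1 - exp (- \<eta> * a powr - \<alpha>))"
  have c: "0 \<le> c" "c \<le> 1" using pos by (auto simp: c_def)
  have z: "0 \<le> z" using pos c by (auto simp: z_def intro!: mult_le_one)
  define J where "J d i = edge_index i ` (snd d - {i})" for d :: "nat set \<times> nat set" and i
  define D where "D \<omega> = (indices A \<omega>, indices U \<omega>)" for \<omega>
  let ?S = "Collect finite \<times> Collect finite :: (nat set \<times> nat set) set"
  have D_PW: "D \<in> measurable PW (count_space ?S)"
    unfolding D_def by (intro measurable_Pair_countable indices_PW A U countable_Collect_finite)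
  note D_M = measurable_from_PW[OF D_PW]
  let ?f = "\<lambda>\<omega>. \<Sum>i\<in>fst (D \<omega>). ennreal (\<Prod>e\<in>J (D \<omega>) i. 1 - c * of_bool (e \<in> edge_pairs \<omega>))"
  have sub: "indices A \<omega> \<subseteq> indices U \<omega>" for \<omega> using A by (auto simp: indices_def)
  have DG: "(\<lambda>\<omega>. (D \<omega>, edge_pairs \<omega>)) \<in> measurable M (count_space (?S \<times> Collect finite))"
    by (intro measurable_Pair_countable[OF D_M edge_pairs_measurable] countable_SIGMA
        countable_Collect_finite)
  have f_meas: "?f \<in> borel_measurable M"
    using measurable_compose[OF DG, of "\<lambda>(d, G). \<Sum>i\<in>fst d. ennreal (\<Prod>e\<in>J d i. 1 - c * of_bool (e \<in> G))" borel]
    by simp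
  have "emeasure M (few_neighbours_event x A U) = (\<integral>\<^sup>+\<omega>. indicator (few_neighbours_event x A U) \<omega> \<partial>M)"
    using few_neighbours_event_measurable[OF A(1) U(1)] by simp
  also have "\<dots> \<le> (\<integral>\<^sup>+\<omega>. ennreal (exp (t * x)) * ?f \<omega> \<partial>M)"
  proof (rule nn_integral_mono)
    fix \<omega> assume "\<omega> \<in> space M"
    show "indicator (few_neighbours_event x A U) \<omega> \<le> ennreal (exp (t * x)) * ?f \<omega>"
    proof (cases "\<omega> \<in> few_neighbours_event x A U")
      case True
      then obtain i where i: "i \<in> indices A \<omega>"
        and few: "real (card (neighbours (edge_pairs \<omega>) (indices U \<omega>) i)) < x"
        by (auto simp: few_neighbours_event_def)
      let ?n = "card (neighbours (edge_pairs \<omega>) (indices U \<omega>) i)"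
      have "1 \<le> exp (t * (x - real ?n))" using few pos by simp
      also have "\<dots> = exp (t * x) * (1 - c) ^ ?n"
        by (simp add: c_def exp_diff algebra_simps exp_minus power_inverse divide_inverse
            flip: exp_of_nat_mult)
      also have "(1 - c) ^ ?n = (\<Prod>e\<in>J (D \<omega>) i. 1 - c * of_bool (e \<in> edge_pairs \<omega>))"
        by (simp add: J_def D_def prod_neighbours finite_indices)
      finally have "1 \<le> ennreal (exp (t * x)) * ennreal (\<Prod>e\<in>J (D \<omega>) i. 1 - c * of_bool (e \<in> edge_pairs \<omega>))"
        by (metis ennreal_1 ennreal_leI ennreal_mult' exp_ge_zero)
      also have "\<dots> \<le> ennreal (exp (t * x)) * ?f \<omega>"
        by (intro mult_left_mono member_le_sum) (use i finite_indices in \<open>auto simp: D_def\<close>)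
      finally show ?thesis by (simp add: True)
    qed simp
  qed
  also have "\<dots> = ennreal (exp (t * x)) * (\<integral>\<^sup>+\<omega>. ?f \<omega> \<partial>M)"
    by (rule nn_integral_cmult[OF f_meas])
  also have "(\<integral>\<^sup>+\<omega>. ?f \<omega> \<partial>M) \<le> (\<integral>\<^sup>+\<omega>. (\<Sum>i\<in>fst (D \<omega>). ennreal (z ^ card (J (D \<omega>) i))) \<partial>M)"
    unfolding z_def
  proof (rule nn_integral_sum_edges_product_le[OF pos(1-4) c D_PW])
    fix \<omega> i e assume "\<omega> \<in> space M" and i: "i \<in> fst (D \<omega>)" and "e \<in> J (D \<omega>) i"
    then obtain j where j: "e = edge_index i j" "j \<noteq> i" "j \<in> indices U \<omega>"
      by (auto simp: J_def D_def)
    have iA: "i \<in> indices A \<omega>" using i by (simp add: D_def)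
    have "torus_dist (X i \<omega>) (X j \<omega>) \<le> a * r" using iA j close by (simp add: indices_def)
    moreover have "i < N \<omega>" "j < N \<omega>" using iA j by (simp_all add: indices_def)
    ultimately show "fst e < snd e \<and> snd e < N \<omega> \<and> torus_dist (X (fst e) \<omega>) (X (snd e) \<omega>) \<le> a * r"
      using j torus_dist_commute[of "X i \<omega>" "X j \<omega>"]
      by (auto simp: edge_index_def min_def max_def)
  qed (auto simp: J_def intro!: countable_SIGMA countable_Collect_finite)
  also have "\<dots> \<le> (\<integral>\<^sup>+\<omega>. ennreal (real (point_count U \<omega>) * z ^ (point_count U \<omega> - 1)) \<partial>M)"
  proof (rule nn_integral_mono)
    fix \<omega> assume \<omega>: "\<omega> \<in> space M"
    have "(\<Sum>i\<in>fst (D \<omega>). ennreal (z ^ card (J (D \<omega>) i))) = (\<Sum>i\<in>indices A \<omega>. ennreal (z ^ (point_count U \<omega> - 1)))"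
    proof (rule sum.cong)
      fix i assume "i \<in> indices A \<omega>"
      then have i: "i \<in> indices U \<omega>" using sub by blast
      have "inj_on (edge_index i) (indices U \<omega> - {i})" by (auto simp: inj_on_def edge_index_eq_iff)
      then have "card (J (D \<omega>) i) = card (indices U \<omega> - {i})" by (simp add: J_def D_def card_image)
      also have "\<dots> = point_count U \<omega> - 1" using i finite_indices card_indices[OF \<omega>] by simp
      finally show "ennreal (z ^ card (J (D \<omega>) i)) = ennreal (z ^ (point_count U \<omega> - 1))" by simp
    qed (simp add: D_def)
    also have "\<dots> = ennreal (real (card (indices A \<omega>)) * z ^ (point_count U \<omega> - 1))"
      using z by (simp add: ennreal_mult ennreal_of_nat_eq_real_of_nat)
    also have "\<dots> \<le> ennreal (real (point_count U \<omega>) * z ^ (point_count U \<omega> - 1))"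
      using card_mono[OF finite_indices sub, of \<omega>] card_indices[OF \<omega>, of U] z
      by (intro ennreal_leI mult_right_mono) auto
    finally show "(\<Sum>i\<in>fst (D \<omega>). ennreal (z ^ card (J (D \<omega>) i)))
        \<le> ennreal (real (point_count U \<omega>) * z ^ (point_count U \<omega> - 1))" .
  qed
  also have "\<dots> = ennreal (l * exp (- l * (1 - z)))" by (rule poisson_pgf_deriv[OF U l z])
  finally have "emeasure M (few_neighbours_event x A U)
      \<le> ennreal (exp (t * x)) * ennreal (l * exp (- l * (1 - z)))"
    by (simp add: mult_left_mono)
  also have "\<dots> = ennreal (exp (t * x) * (l * exp (- l * (1 - z))))"
    using l by (simp add: ennreal_mult)
  finally have "prob (few_neighbours_event x A U) \<le> exp (t * x) * (l * exp (- l * (1 - z)))"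
    using l by (simp add: emeasure_eq_measure)
  then show ?thesis by (simp add: z_def c_def)
qed

text \<open>
  A union bound over all pairs of disjoint vertex sets in \<open>V\<close>. There are at most \<open>4\<^sup>n\<close> of them when
  \<open>V\<close> contains \<open>n\<close> points, and each pair with at least \<open>x\<close> vertices on both sides has at least
  \<open>x\<^sup>2\<close> potential edges. For \<open>x\<close> and \<open>l\<close> of order \<open>log s\<close> the quadratic exponent wins.
\<close>

lemma prob_separated_event_le:
  assumes pos: "0 < \<eta>" "0 < \<alpha>" "0 < r" "0 < a" "0 \<le> x"
    and V: "V \<in> sets borel" "V \<subseteq> torus"
    and close: "\<And>x y. x \<in> V \<Longrightarrow> y \<in> V \<Longrightarrow> torus_dist x y \<le> a * r"
    and l: "l = s * measure lborel V" "0 \<le> l"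
  shows "prob (separated_event x V) \<le> exp (- \<eta> * a powr - \<alpha> * x\<^sup>2) * exp (3 * l)"
proof -
  define q where "q = \<eta> * a powr - \<alpha>"
  have q: "0 \<le> q" using pos by (simp add: q_def)
  define J where "J I p = (\<lambda>(i, j). edge_index i j) ` (fst p \<times> snd p)"
    for I :: "nat set" and p :: "nat set \<times> nat set"
  note D_PW = indices_PW[OF V(1)]
  note D_M = measurable_from_PW[OF D_PW]
  let ?f = "\<lambda>\<omega>. \<Sum>p\<in>separated_pairs x (indices V \<omega>).
    ennreal (\<Prod>e\<in>J (indices V \<omega>) p. 1 - 1 * of_bool (e \<in> edge_pairs \<omega>))"
  have fin: "finite (J I p)" if "finite I" "p \<in> separated_pairs x I" for I p
    using that unfolding J_def separated_pairs_def
    by (intro finite_imageI finite_cartesian_product) (auto dest: finite_subset)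
  have "emeasure M (separated_event x V) = (\<integral>\<^sup>+\<omega>. indicator (separated_event x V) \<omega> \<partial>M)"
    using separated_event_measurable[OF V(1)] by simp
  also have "\<dots> \<le> (\<integral>\<^sup>+\<omega>. ?f \<omega> \<partial>M)"
  proof (rule nn_integral_mono)
    fix \<omega> assume "\<omega> \<in> space M"
    show "indicator (separated_event x V) \<omega> \<le> ?f \<omega>"
    proof (cases "\<omega> \<in> separated_event x V")
      case True
      then obtain S T where ST: "(S, T) \<in> separated_pairs x (indices V \<omega>)"
        and none: "no_edge_between (edge_pairs \<omega>) S T"
        by (auto simp: separated_event_def)
      have "(\<Prod>e\<in>J (indices V \<omega>) (S, T). 1 - 1 * of_bool (e \<in> edge_pairs \<omega>)) = (1 :: real)"
        using none by (intro prod.neutral) (auto simp: J_def no_edge_between_def)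
      then have "1 = ennreal (\<Prod>e\<in>J (indices V \<omega>) (S, T). 1 - 1 * of_bool (e \<in> edge_pairs \<omega>))" by simp
      also have "\<dots> \<le> ?f \<omega>"
        by (rule member_le_sum[OF ST]) (auto intro: finite_separated_pairs finite_indices)
      finally show ?thesis by (simp add: True)
    qed simp
  qed
  also have "\<dots> \<le> (\<integral>\<^sup>+\<omega>. (\<Sum>p\<in>separated_pairs x (indices V \<omega>).
      ennreal ((1 - 1 * (1 - exp (- \<eta> * a powr - \<alpha>))) ^ card (J (indices V \<omega>) p))) \<partial>M)"
  proof (rule nn_integral_sum_edges_product_le[OF pos(1-4) _ _ D_PW])
    fix \<omega> p e assume "\<omega> \<in> space M" and "p \<in> separated_pairs x (indices V \<omega>)"
      and "e \<in> J (indices V \<omega>) p"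
    then obtain i j where ij: "e = edge_index i j" "i \<noteq> j" "i \<in> indices V \<omega>" "j \<in> indices V \<omega>"
      by (fastforce simp: J_def separated_pairs_def)
    have "torus_dist (X i \<omega>) (X j \<omega>) \<le> a * r" using ij close by (simp add: indices_def)
    moreover have "i < N \<omega>" "j < N \<omega>" using ij by (simp_all add: indices_def)
    ultimately show "fst e < snd e \<and> snd e < N \<omega> \<and> torus_dist (X (fst e) \<omega>) (X (snd e) \<omega>) \<le> a * r"
      using ij torus_dist_commute[of "X i \<omega>" "X j \<omega>"]
      by (auto simp: edge_index_def min_def max_def)
  qed (auto intro: countable_Collect_finite finite_separated_pairs fin)
  also have "\<dots> \<le> (\<integral>\<^sup>+\<omega>. ennreal (exp (- q * x\<^sup>2)) * ennreal (4 ^ point_count V \<omega>) \<partial>M)"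
  proof (rule nn_integral_mono)
    fix \<omega> assume \<omega>: "\<omega> \<in> space M"
    have "(\<Sum>p\<in>separated_pairs x (indices V \<omega>).
        ennreal ((1 - 1 * (1 - exp (- \<eta> * a powr - \<alpha>))) ^ card (J (indices V \<omega>) p)))
      \<le> (\<Sum>p\<in>separated_pairs x (indices V \<omega>). ennreal (exp (- q * x\<^sup>2)))"
    proof (intro sum_mono ennreal_leI)
      fix p assume "p \<in> separated_pairs x (indices V \<omega>)"
      then obtain S T where p: "p = (S, T)" "S \<inter> T = {}" "x \<le> card S" "x \<le> card T"
        by (auto simp: separated_pairs_def)
      have "x\<^sup>2 \<le> real (card S) * real (card T)"
        unfolding power2_eq_square using p pos by (intro mult_mono) auto
      then have "q * x\<^sup>2 \<le> real (card S * card T) * q" using q by (simp add: mult_left_mono mult.commute)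
      then have "exp (- q) ^ (card S * card T) \<le> exp (- q * x\<^sup>2)"
        by (simp add: algebra_simps flip: exp_of_nat_mult)
      then show "(1 - 1 * (1 - exp (- \<eta> * a powr - \<alpha>))) ^ card (J (indices V \<omega>) p) \<le> exp (- q * x\<^sup>2)"
        using p by (simp add: J_def card_edge_index_image q_def)
    qed
    also have "\<dots> = ennreal (real (card (separated_pairs x (indices V \<omega>))) * exp (- q * x\<^sup>2))"
      by (simp add: ennreal_mult ennreal_of_nat_eq_real_of_nat)
    also have "\<dots> \<le> ennreal (4 ^ point_count V \<omega> * exp (- q * x\<^sup>2))"
    proof (intro ennreal_leI mult_right_mono)
      have "real (card (separated_pairs x (indices V \<omega>))) \<le> real (4 ^ card (indices V \<omega>))"
        using card_separated_pairs_le[OF finite_indices] of_nat_le_iff by blast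
      then show "real (card (separated_pairs x (indices V \<omega>))) \<le> 4 ^ point_count V \<omega>"
        using card_indices[OF \<omega>] by simp
    qed simp
    finally show "(\<Sum>p\<in>separated_pairs x (indices V \<omega>).
        ennreal ((1 - 1 * (1 - exp (- \<eta> * a powr - \<alpha>))) ^ card (J (indices V \<omega>) p)))
      \<le> ennreal (exp (- q * x\<^sup>2)) * ennreal (4 ^ point_count V \<omega>)"
      by (simp add: ennreal_mult mult.commute)
  qed
  also have "\<dots> = ennreal (exp (- q * x\<^sup>2)) * (\<integral>\<^sup>+\<omega>. ennreal (4 ^ point_count V \<omega>) \<partial>M)"
    using measurable_compose[OF point_count_measurable[OF V], of "\<lambda>k. ennreal (4 ^ k)" borel]
    by (intro nn_integral_cmult) simp
  \<comment> \<open>The generating function at 4 yields the factor \<open>exp (3 l)\<close>.\<close>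
  also have "(\<integral>\<^sup>+\<omega>. ennreal (4 ^ point_count V \<omega>) \<partial>M) = ennreal (exp (- l * (1 - 4)))"
    by (rule poisson_pgf[OF V l]) simp
  also have "ennreal (exp (- q * x\<^sup>2)) * \<dots> = ennreal (exp (- q * x\<^sup>2) * exp (3 * l))"
    by (simp add: ennreal_mult mult.commute)
  finally show ?thesis by (simp add: emeasure_eq_measure q_def)
qed

end

section \<open>Connectivity from local properties\<close>

lemma rtrancl_image:
  assumes "(x, y) \<in> R\<^sup>*" "\<And>u v. (u, v) \<in> R \<Longrightarrow> (f u, f v) \<in> S"
  shows "(f x, f y) \<in> S\<^sup>*"
  using assms(1) by induction (auto intro: assms(2) rtrancl_into_rtrancl)

text \<open>
  Connectivity is transferred to the indices of the points, where it is a property of a finite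
  amount of discrete data; this makes it measurable.
\<close>

definition index_graph :: "nat \<Rightarrow> (nat \<times> nat) set \<Rightarrow> (nat \<times> nat) set" where
  "index_graph n G = {(i, j). i < n \<and> j < n \<and> edge_index i j \<in> G}"

context weighted_random_graph
begin

lemma edge_index_in_edge_pairs_iff:
  assumes \<omega>: "\<omega> \<in> space M" and "i < N \<omega>" "j < N \<omega>"
  shows "edge_index i j \<in> edge_pairs \<omega> \<longleftrightarrow> {X i \<omega>, X j \<omega>} \<in> E \<omega>"
proof (cases "i = j")
  case True
  have "{X i \<omega>} \<notin> E \<omega>" using edges_between_points[OF \<omega>, of "{X i \<omega>}"] by auto
  then show ?thesis using True by (simp add: edge_index_def edge_pairs_def)
next
  case False
  then show ?thesis using assms
    by (auto simp: edge_index_def edge_pairs_def min_def max_def insert_commute)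
qed

lemma graph_connected_iff_index_graph:
  assumes \<omega>: "\<omega> \<in> space M"
  shows "graph_connected (point_set N X \<omega>) (E \<omega>)
    \<longleftrightarrow> (\<forall>i<N \<omega>. \<forall>j<N \<omega>. (i, j) \<in> (index_graph (N \<omega>) (edge_pairs \<omega>))\<^sup>*)"
    (is "?L \<longleftrightarrow> ?R")
proof -
  let ?V = "point_set N X \<omega>"
  let ?r = "{(u, v). u \<in> ?V \<and> v \<in> ?V \<and> {u, v} \<in> E \<omega>}"
  let ?f = "\<lambda>i. X i \<omega>"
  let ?g = "the_inv_into {..<N \<omega>} ?f"
  have V: "?V = ?f ` {..<N \<omega>}" by (simp add: point_set_def)
  have inj: "inj_on ?f {..<N \<omega>}" by (rule points_distinct[OF \<omega>])
  have g: "?g (X i \<omega>) = i" if "i < N \<omega>" for i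
    using the_inv_into_f_f[OF inj, of i] that by simp
  have fwd: "(?f i, ?f j) \<in> ?r" if "(i, j) \<in> index_graph (N \<omega>) (edge_pairs \<omega>)" for i j
    using that edge_index_in_edge_pairs_iff[OF \<omega>] by (auto simp: index_graph_def V)
  have bwd: "(?g u, ?g v) \<in> index_graph (N \<omega>) (edge_pairs \<omega>)" if "(u, v) \<in> ?r" for u v
  proof -
    have "u \<in> ?V" "v \<in> ?V" using that by auto
    then obtain i j where ij: "i < N \<omega>" "j < N \<omega>" "u = X i \<omega>" "v = X j \<omega>" by (auto simp: V)
    then show ?thesis using that edge_index_in_edge_pairs_iff[OF \<omega>, of i j]
      by (simp add: g index_graph_def)
  qed
  show ?thesis
  proof
    assume L: ?L
    show ?R
    proof (intro allI impI)
      fix i j assume ij: "i < N \<omega>" "j < N \<omega>"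
      then have "(?f i, ?f j) \<in> ?r\<^sup>*" using L by (auto simp: graph_connected_def V)
      then have "(?g (?f i), ?g (?f j)) \<in> (index_graph (N \<omega>) (edge_pairs \<omega>))\<^sup>*"
        by (rule rtrancl_image) (rule bwd)
      then show "(i, j) \<in> (index_graph (N \<omega>) (edge_pairs \<omega>))\<^sup>*" using ij by (simp add: g)
    qed
  next
    assume R: ?R
    show ?L unfolding graph_connected_def
    proof (intro ballI)
      fix u v assume "u \<in> ?V" "v \<in> ?V"
      then obtain i j where ij: "i < N \<omega>" "j < N \<omega>" "u = X i \<omega>" "v = X j \<omega>" by (auto simp: V)
      then have "(i, j) \<in> (index_graph (N \<omega>) (edge_pairs \<omega>))\<^sup>*" using R by blast
      then have "(?f i, ?f j) \<in> ?r\<^sup>*" by (rule rtrancl_image) (rule fwd)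
      then show "(u, v) \<in> ?r\<^sup>*" using ij by simp
    qed
  qed
qed

lemma graph_connected_measurable:
  "{\<omega> \<in> space M. graph_connected (point_set N X \<omega>) (E \<omega>)} \<in> sets M"
proof -
  have "(\<lambda>\<omega>. (N \<omega>, edge_pairs \<omega>)) \<in> measurable M (count_space (UNIV \<times> Collect finite))"
    by (intro measurable_Pair_countable number_measurable edge_pairs_measurable
        countable_Collect_finite) simp
  from sets_Collect_countable_valued[OF this,
      of "\<lambda>(n, G). \<forall>i<n. \<forall>j<n. (i, j) \<in> (index_graph n G)\<^sup>*"]
  have "{\<omega> \<in> space M. \<forall>i<N \<omega>. \<forall>j<N \<omega>. (i, j) \<in> (index_graph (N \<omega>) (edge_pairs \<omega>))\<^sup>*} \<in> sets M"
    by simp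
  also have "{\<omega> \<in> space M. \<forall>i<N \<omega>. \<forall>j<N \<omega>. (i, j) \<in> (index_graph (N \<omega>) (edge_pairs \<omega>))\<^sup>*}
      = {\<omega> \<in> space M. graph_connected (point_set N X \<omega>) (E \<omega>)}"
    using graph_connected_iff_index_graph by blast
  finally show ?thesis .
qed

text \<open>
  The three radii interlock: a ball of radius \<open>(1 - \<delta>) r\<close> around \<open>c\<close> lies within \<open>r\<close> of every point
  that is within \<open>\<delta> r\<close> of \<open>c\<close>, and radius \<open>3 r\<close> leaves room for the neighbourhoods, again of radius
  \<open>r\<close>, of all vertices that are within distance \<open>2 r\<close> of \<open>c\<close>.
\<close>

definition bad_event :: "real \<Rightarrow> real \<Rightarrow> real ^ 'n \<Rightarrow> 'w set" where
  "bad_event \<delta> x c = empty_event (torus_ball c ((1 - \<delta>) * r))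
     \<union> few_neighbours_event x (torus_ball c (\<delta> * r)) (torus_ball c ((1 - \<delta>) * r))
     \<union> separated_event x (torus_ball c (3 * r))"

text \<open>
  Two vertices near a common place have many neighbours each. These neighbourhoods either meet or,
  both being large and close to each other, are joined by an edge; so the two vertices are connected by
  a path of at most three edges. As every place of the torus has a vertex near it, being connected
  through nearby vertices is an equivalence relation on places. It is locally trivial and the
  torus, as a convex set, is connected, so there is a single class.
\<close>

lemma graph_connected_if_no_bad_event:
  assumes r: "0 < r" and \<delta>: "0 < \<delta>" "\<delta> \<le> 1/2"
    and net: "C \<subseteq> torus" "\<And>p. p \<in> torus \<Longrightarrow> \<exists>c\<in>C. norm (c - p) \<le> \<delta> * r / 2"
    and \<omega>: "\<omega> \<in> space M" and good: "\<And>c. c \<in> C \<Longrightarrow> \<omega> \<notin> bad_event \<delta> x c"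
  shows "graph_connected (point_set N X \<omega>) (E \<omega>)"
proof -
  let ?G = "edge_pairs \<omega>"
  let ?R = "index_graph (N \<omega>) ?G"
  define conn where "conn i j \<longleftrightarrow> (i, j) \<in> ?R\<^sup>*" for i j
  have sym_R: "sym ?R" by (auto simp: sym_def index_graph_def edge_index_commute)
  have conn_sym: "conn i j \<Longrightarrow> conn j i" for i j
    using sym_rtrancl[OF sym_R] by (auto simp: conn_def sym_def)
  have conn_trans: "conn i j \<Longrightarrow> conn j k \<Longrightarrow> conn i k" for i j k
    by (auto simp: conn_def)
  have edge: "conn i j" if "i < N \<omega>" "j < N \<omega>" "edge_index i j \<in> ?G" for i j
    using that by (auto simp: conn_def index_graph_def)
  have \<delta>r: "0 < \<delta> * r" "\<delta> * r \<le> r / 2" using r \<delta> by auto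
  have centre: "\<exists>c\<in>C. torus_dist c p \<le> \<delta> * r / 2" if "p \<in> torus" for p
    using net(2)[OF that] torus_dist_le_norm order_trans by blast
  have X_torus: "X i \<omega> \<in> torus" if "i < N \<omega>" for i using point_in_torus[OF \<omega> that] .

  have many: "\<exists>S. finite S \<and> x \<le> card S
      \<and> (\<forall>j\<in>S. j < N \<omega> \<and> edge_index i j \<in> ?G \<and> torus_dist (X i \<omega>) (X j \<omega>) < r)"
    if i: "i < N \<omega>" for i
  proof -
    obtain c where c: "c \<in> C" "torus_dist c (X i \<omega>) \<le> \<delta> * r / 2" using centre X_torus i by blast
    let ?U = "torus_ball c ((1 - \<delta>) * r)"
    let ?S = "neighbours ?G (indices ?U \<omega>) i"
    have "\<omega> \<notin> few_neighbours_event x (torus_ball c (\<delta> * r)) ?U"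
      using good[OF c(1)] by (simp add: bad_event_def)
    moreover have "i \<in> indices (torus_ball c (\<delta> * r)) \<omega>"
      using i c \<delta>r X_torus by (simp add: indices_def torus_ball_def)
    ultimately have "x \<le> card ?S" using \<omega> by (auto simp: few_neighbours_event_def not_less)
    moreover have "finite ?S" using finite_indices by (simp add: neighbours_def)
    moreover have "j < N \<omega> \<and> edge_index i j \<in> ?G \<and> torus_dist (X i \<omega>) (X j \<omega>) < r"
      if "j \<in> ?S" for j
    proof -
      have "torus_dist c (X j \<omega>) < (1 - \<delta>) * r"
        using that by (simp add: neighbours_def indices_def torus_ball_def)
      then have "torus_dist (X i \<omega>) (X j \<omega>) < r"
        using torus_dist_triangle[of "X i \<omega>" "X j \<omega>" c] torus_dist_commute[of c "X i \<omega>"] c \<delta>r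
        by (simp add: algebra_simps)
      then show ?thesis using that by (simp add: neighbours_def indices_def)
    qed
    ultimately show ?thesis by blast
  qed

  have near: "conn i j"
    if p: "p \<in> torus" and ij: "i < N \<omega>" "j < N \<omega>"
      and dist: "torus_dist p (X i \<omega>) \<le> 7/4 * r" "torus_dist p (X j \<omega>) \<le> 7/4 * r" for p i j
  proof -
    obtain c where c: "c \<in> C" "torus_dist c p \<le> \<delta> * r / 2" using centre p by blast
    have in_V: "l \<in> indices (torus_ball c (3 * r)) \<omega>"
      if "l < N \<omega>" "torus_dist (X k \<omega>) (X l \<omega>) < r" "torus_dist p (X k \<omega>) \<le> 7/4 * r" for k l
      using that torus_dist_triangle[of c "X l \<omega>" "X k \<omega>"] torus_dist_triangle[of c "X k \<omega>" p]
        c \<delta>r X_torus by (simp add: indices_def torus_ball_def)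
    obtain S where S: "finite S" "x \<le> card S"
      "\<forall>k\<in>S. k < N \<omega> \<and> edge_index i k \<in> ?G \<and> torus_dist (X i \<omega>) (X k \<omega>) < r"
      using many ij(1) by blast
    obtain T where T: "finite T" "x \<le> card T"
      "\<forall>k\<in>T. k < N \<omega> \<and> edge_index j k \<in> ?G \<and> torus_dist (X j \<omega>) (X k \<omega>) < r"
      using many ij(2) by blast
    have iS: "conn i k" if "k \<in> S" for k using edge ij S that by blast
    have Tj: "conn k j" if "k \<in> T" for k using edge ij T that conn_sym by blast
    show ?thesis
    proof (cases "S \<inter> T = {}")
      case False
      then show ?thesis using iS Tj conn_trans by blast
    next
      case True
      have "S \<subseteq> indices (torus_ball c (3 * r)) \<omega>" "T \<subseteq> indices (torus_ball c (3 * r)) \<omega>"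
        using S T in_V dist by blast+
      then have "(S, T) \<in> separated_pairs x (indices (torus_ball c (3 * r)) \<omega>)"
        using S T True by (simp add: separated_pairs_def)
      moreover have "\<omega> \<notin> separated_event x (torus_ball c (3 * r))"
        using good[OF c(1)] by (simp add: bad_event_def)
      ultimately have "\<not> no_edge_between ?G S T" using \<omega> by (auto simp: separated_event_def)
      then obtain k l where kl: "k \<in> S" "l \<in> T" "edge_index k l \<in> ?G"
        by (auto simp: no_edge_between_def)
      then have "conn k l" using edge S T by blast
      then show ?thesis using iS[OF kl(1)] Tj[OF kl(2)] conn_trans by blast
    qed
  qed

  have witness: "\<exists>i<N \<omega>. torus_dist p (X i \<omega>) < r" if p: "p \<in> torus" for p
  proof -
    obtain c where c: "c \<in> C" "torus_dist c p \<le> \<delta> * r / 2" using centre p by blast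
    have "\<omega> \<notin> empty_event (torus_ball c ((1 - \<delta>) * r))"
      using good[OF c(1)] by (simp add: bad_event_def)
    then obtain i where "i < N \<omega>" "torus_dist c (X i \<omega>) < (1 - \<delta>) * r"
      using \<omega> by (auto simp: empty_event_def indices_def torus_ball_def)
    then show ?thesis
      using c \<delta>r torus_dist_triangle[of p "X i \<omega>" c] torus_dist_commute[of c p]
      by (intro exI[of _ i]) (simp add: algebra_simps)
  qed

  \<comment> \<open>The existence of a vertex near the middle place makes this relation transitive.\<close>
  define linked where "linked p q \<longleftrightarrow> (\<forall>i<N \<omega>. \<forall>j<N \<omega>.
      torus_dist p (X i \<omega>) < r \<longrightarrow> torus_dist q (X j \<omega>) < r \<longrightarrow> conn i j)" for p q
  have "linked p q" if pq: "p \<in> torus" "q \<in> torus" for p q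
  proof (rule connected_equivalence_relation[OF convex_connected[OF convex_torus] pq])
    show "linked q p" if "linked p q" for p q
      using that conn_sym unfolding linked_def by blast
    show "linked p w" if "linked p q" "linked q w" "q \<in> torus" for p q w
      using that witness conn_trans unfolding linked_def by meson
    show "\<exists>T. openin (top_of_set torus) T \<and> p \<in> T \<and> (\<forall>q\<in>T. linked p q)" if p: "p \<in> torus" for p
    proof (intro exI conjI ballI)
      show "openin (top_of_set torus) (torus \<inter> ball p (r / 4))" by (simp add: openin_open_Int)
      show "p \<in> torus \<inter> ball p (r / 4)" using p r by simp
      fix q assume q: "q \<in> torus \<inter> ball p (r / 4)"
      then have pq: "torus_dist p q < r / 4"
        using torus_dist_le_norm[of p q] by (simp add: dist_norm)
      show "linked p q" unfolding linked_def
      proof (intro allI impI)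
        fix i j assume "i < N \<omega>" "j < N \<omega>" "torus_dist p (X i \<omega>) < r" "torus_dist q (X j \<omega>) < r"
        then show "conn i j"
          using near[OF p, of i j] pq r torus_dist_triangle[of p "X j \<omega>" q] by simp
      qed
    qed
  qed
  then have "conn i j" if "i < N \<omega>" "j < N \<omega>" for i j
  proof -
    have "torus_dist p p < r" for p :: "real ^ 'n" using torus_dist_le_norm[of p p] r by simp
    then show ?thesis using that X_torus \<open>\<And>p q. p \<in> torus \<Longrightarrow> q \<in> torus \<Longrightarrow> linked p q\<close>
      unfolding linked_def by blast
  qed
  then show ?thesis by (simp add: graph_connected_iff_index_graph[OF \<omega>] conn_def)
qed

text \<open>
  Connections to the points in the ball of radius \<open>(1 - \<delta>) r\<close> span at most \<open>r\<close>, and those inside the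
  ball of radius \<open>3 r\<close> span at most \<open>6 r\<close>; this is where the two connection probabilities
  \<open>1 - exp (- \<eta>)\<close> and \<open>1 - exp (- \<eta> 6 powr (- \<alpha>))\<close> come from. The bound on \<open>r\<close> keeps the
  balls from wrapping onto themselves.
\<close>

lemma prob_bad_event_le:
  fixes c :: "real ^ 'n"
  assumes pos: "0 < \<eta>" "0 < \<alpha>" "0 < r" "0 \<le> s" and small: "3 * r \<le> 1/2"
    and \<delta>: "0 < \<delta>" "\<delta> \<le> 1/2" and tx: "0 \<le> t" "0 \<le> x"
    and \<theta>: "\<theta> = measure lborel (ball (0 :: real ^ 'n) 1)"
    and l: "l = s * (\<theta> * ((1 - \<delta>) * r) ^ CARD('n))"
    and m: "m = s * (\<theta> * (3 * r) ^ CARD('n))"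
  shows "bad_event \<delta> x c \<in> sets M"
    and "prob (bad_event \<delta> x c) \<le> exp (- l)
      + exp (t * x) * (l * exp (- l * ((1 - exp (- t)) * (1 - exp (- \<eta>)))))
      + exp (- \<eta> * 6 powr - \<alpha> * x\<^sup>2) * exp (3 * m)"
proof -
  let ?A = "torus_ball c (\<delta> * r)" and ?U = "torus_ball c ((1 - \<delta>) * r)" and ?V = "torus_ball c (3 * r)"
  have \<theta>0: "0 \<le> \<theta>" by (simp add: \<theta>)
  have "(1 - \<delta>) * r \<le> 1 * r" using pos \<delta> by (intro mult_right_mono) auto
  then have "(1 - \<delta>) * r \<le> 1/2" using small pos by linarith
  then have U: "measure lborel ?U = \<theta> * ((1 - \<delta>) * r) ^ CARD('n)"
    unfolding \<theta> using pos \<delta> by (intro measure_torus_ball mult_pos_pos) auto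
  have V: "measure lborel ?V = \<theta> * (3 * r) ^ CARD('n)"
    unfolding \<theta> using pos small by (intro measure_torus_ball) auto
  have l_eq: "l = s * measure lborel ?U" "0 \<le> l" using U l pos \<delta> \<theta>0 by simp_all
  have m_eq: "m = s * measure lborel ?V" "0 \<le> m" using V m pos \<theta>0 by simp_all
  have events: "empty_event ?U \<in> sets M" "few_neighbours_event x ?A ?U \<in> sets M"
    "separated_event x ?V \<in> sets M"
    by (simp_all add: empty_event_measurable few_neighbours_event_measurable
        separated_event_measurable torus_ball_in_sets)
  then show "bad_event \<delta> x c \<in> sets M" by (simp add: bad_event_def)
  have "prob (bad_event \<delta> x c)
      \<le> prob (empty_event ?U \<union> few_neighbours_event x ?A ?U) + prob (separated_event x ?V)"
    unfolding bad_event_def using events by (intro measure_Un_le) auto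
  also have "\<dots> \<le> prob (empty_event ?U) + prob (few_neighbours_event x ?A ?U) + prob (separated_event x ?V)"
    using events by (intro add_right_mono measure_Un_le) auto
  finally have "prob (bad_event \<delta> x c)
      \<le> prob (empty_event ?U) + prob (few_neighbours_event x ?A ?U) + prob (separated_event x ?V)" .
  moreover have "prob (empty_event ?U) = exp (- l)"
    by (simp add: prob_empty_event torus_ball_in_sets torus_ball_subset l_eq(1))
  moreover have "prob (few_neighbours_event x ?A ?U)
      \<le> exp (t * x) * (l * exp (- l * ((1 - exp (- t)) * (1 - exp (- \<eta> * 1 powr - \<alpha>)))))"
  proof (rule prob_few_neighbours_event_le[OF pos(1-3) _ tx(1) torus_ball_in_sets _
        torus_ball_in_sets torus_ball_subset _ l_eq])
    have "\<delta> * r \<le> (1 - \<delta>) * r" using \<delta> pos by (intro mult_right_mono) auto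
    then show "?A \<subseteq> ?U" by (auto simp: torus_ball_def)
    fix y z assume "y \<in> ?A" "z \<in> ?U"
    then show "torus_dist y z \<le> 1 * r"
      using torus_dist_triangle[of y z c] torus_dist_commute[of c y]
      by (simp add: torus_ball_def algebra_simps)
  qed simp
  moreover have "prob (separated_event x ?V) \<le> exp (- \<eta> * 6 powr - \<alpha> * x\<^sup>2) * exp (3 * m)"
  proof (rule prob_separated_event_le[OF pos(1-3) _ tx(2) torus_ball_in_sets torus_ball_subset _ m_eq])
    fix y z assume "y \<in> ?V" "z \<in> ?V"
    then show "torus_dist y z \<le> 6 * r"
      using torus_dist_triangle[of y z c] torus_dist_commute[of c y] by (simp add: torus_ball_def)
  qed simp
  ultimately show "prob (bad_event \<delta> x c) \<le> exp (- l)
      + exp (t * x) * (l * exp (- l * ((1 - exp (- t)) * (1 - exp (- \<eta>)))))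
      + exp (- \<eta> * 6 powr - \<alpha> * x\<^sup>2) * exp (3 * m)" by simp
qed

lemma prob_graph_connected_ge:
  assumes pos: "0 < \<eta>" "0 < \<alpha>" "0 < r" "0 \<le> s" and small: "3 * r \<le> 1/2"
    and \<delta>: "0 < \<delta>" "\<delta> \<le> 1/2" and tx: "0 \<le> t" "0 \<le> x"
    and \<theta>: "\<theta> = measure lborel (ball (0 :: real ^ 'n) 1)"
    and l: "l = s * (\<theta> * ((1 - \<delta>) * r) ^ CARD('n))"
    and m: "m = s * (\<theta> * (3 * r) ^ CARD('n))"
  shows "1 - (4 * real CARD('n) / (\<delta> * r)) ^ CARD('n) * (exp (- l)
      + exp (t * x) * (l * exp (- l * ((1 - exp (- t)) * (1 - exp (- \<eta>)))))
      + exp (- \<eta> * 6 powr - \<alpha> * x\<^sup>2) * exp (3 * m))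
    \<le> prob {\<omega> \<in> space M. graph_connected (point_set N X \<omega>) (E \<omega>)}"
proof -
  let ?b = "exp (- l) + exp (t * x) * (l * exp (- l * ((1 - exp (- t)) * (1 - exp (- \<eta>)))))
    + exp (- \<eta> * 6 powr - \<alpha> * x\<^sup>2) * exp (3 * m)"
  let ?good = "{\<omega> \<in> space M. graph_connected (point_set N X \<omega>) (E \<omega>)}"
  note bad = prob_bad_event_le[OF pos small \<delta> tx \<theta> l m]
  have "\<delta> * r \<le> 1 * r" using \<delta> pos by (intro mult_right_mono) auto
  then have \<epsilon>: "0 < \<delta> * r / 2" "\<delta> * r / 2 \<le> 1" using mult_pos_pos[OF \<delta>(1) pos(3)] small by linarith+
  obtain C :: "(real ^ 'n) set" where C: "finite C" "C \<subseteq> torus"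
    "\<And>p. p \<in> torus \<Longrightarrow> \<exists>c\<in>C. norm (c - p) \<le> \<delta> * r / 2"
    "real (card C) \<le> (2 * real CARD('n) / (\<delta> * r / 2)) ^ CARD('n)"
    using torus_finite_net[OF \<epsilon>] by blast
  have "space M - ?good \<subseteq> (\<Union>c\<in>C. bad_event \<delta> x c)"
    using graph_connected_if_no_bad_event[OF pos(3) \<delta> C(2,3)] by blast
  then have "prob (space M - ?good) \<le> prob (\<Union>c\<in>C. bad_event \<delta> x c)"
    using bad(1) C(1) by (intro finite_measure_mono) auto
  also have "\<dots> \<le> (\<Sum>c\<in>C. prob (bad_event \<delta> x c))"
    using bad(1) C(1) by (intro finite_measure_subadditive_finite) auto
  also have "\<dots> \<le> (\<Sum>c\<in>C. ?b)" by (intro sum_mono bad(2))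
  also have "\<dots> = real (card C) * ?b" by simp
  also have "\<dots> \<le> (4 * real CARD('n) / (\<delta> * r)) ^ CARD('n) * ?b"
  proof (rule mult_right_mono)
    show "real (card C) \<le> (4 * real CARD('n) / (\<delta> * r)) ^ CARD('n)" using C(4) by simp
    have "0 \<le> l" using l pos \<delta> \<theta> by simp
    then show "0 \<le> ?b" by (intro add_nonneg_nonneg mult_nonneg_nonneg) auto
  qed
  finally show ?thesis using prob_compl[OF graph_connected_measurable] by simp
qed

end

section \<open>The choice of constants and the limit\<close>

text \<open>
  A non-integrable function has integral 0, so in that case the bound is trivial.
\<close>

lemma integral_unit_ball_le_volume:
  assumes \<mu>: "prob_space \<mu>"
    and f: "\<And>z w. f z w \<le> (1 :: real)"
  shows "(LINT z:ball (0 :: real ^ 'n) 1|lborel. (LINT w|\<mu>. f z w))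
    \<le> measure lborel (ball (0 :: real ^ 'n) 1)"
proof -
  interpret prob_space \<mu> by (rule \<mu>)
  let ?B = "ball (0 :: real ^ 'n) 1"
  have inner: "(LINT w|\<mu>. f z w) \<le> 1" for z
  proof (cases "integrable \<mu> (f z)")
    case True
    then have "(LINT w|\<mu>. f z w) \<le> (LINT w|\<mu>. 1)" by (intro integral_mono f) auto
    then show ?thesis by (simp add: prob_space)
  qed (simp add: not_integrable_integral_eq)
  show ?thesis
  proof (cases "set_integrable lborel ?B (\<lambda>z. LINT w|\<mu>. f z w)")
    case True
    have "(LINT z:?B|lborel. (LINT w|\<mu>. f z w)) \<le> (LINT z:?B|lborel. 1)"
      by (rule set_integral_mono[OF True])
        (use inner emeasure_lborel_ball_finite[of "0 :: real ^ 'n" 1] in \<open>auto simp: set_integrable_def\<close>)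
    also have "\<dots> = measure lborel ?B" by (simp add: set_lebesgue_integral_def)
    finally show ?thesis .
  next
    case False
    then show ?thesis
      by (simp add: set_integrable_def set_lebesgue_integral_def not_integrable_integral_eq)
  qed
qed

text \<open>
  The factor \<open>s\<close> that counts the places is beaten by \<open>s powr (- b\<^sub>1)\<close>, by \<open>s powr (- b\<^sub>2)\<close>
  and by \<open>exp (- h (log s)\<^sup>2)\<close>. In the second term the factor \<open>log s\<close> is cancelled by the
  denominator.
\<close>

lemma failure_bound_tendsto_zero:
  fixes b\<^sub>1 b\<^sub>2 h c K a :: real
  assumes "1 < b\<^sub>1" "1 < b\<^sub>2" "0 < h"
  shows "((\<lambda>s. K * s / ln s * (exp (- b\<^sub>1 * ln s) + a * ln s * exp (- b\<^sub>2 * ln s)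
      + exp (- h * (ln s)\<^sup>2 + c * ln s))) \<longlongrightarrow> 0) at_top"
proof -
  define u where "u = b\<^sub>1 - 1"
  define v where "v = b\<^sub>2 - 1"
  have uv: "0 < u" "0 < v" using assms by (auto simp: u_def v_def)
  have "((\<lambda>L. exp (- u * L) / L) \<longlongrightarrow> 0) at_top" "((\<lambda>L. exp (- v * L)) \<longlongrightarrow> 0) at_top"
    using uv by real_asymp+
  moreover have "((\<lambda>L. exp (- h * L\<^sup>2 + (c + 1) * L) / L) \<longlongrightarrow> 0) at_top"
    using assms(3) by real_asymp
  ultimately have "((\<lambda>L. K * (exp (- u * L) / L + a * exp (- v * L) + exp (- h * L\<^sup>2 + (c + 1) * L) / L))
      \<longlongrightarrow> K * (0 + a * 0 + 0)) at_top"
    by (intro tendsto_intros)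
  then have "((\<lambda>L. K * (exp (- u * L) / L + a * exp (- v * L) + exp (- h * L\<^sup>2 + (c + 1) * L) / L))
      \<longlongrightarrow> 0) at_top"
    by simp
  from filterlim_compose[OF this ln_at_top]
  have "((\<lambda>s. K * (exp (- u * ln s) / ln s + a * exp (- v * ln s)
      + exp (- h * (ln s)\<^sup>2 + (c + 1) * ln s) / ln s)) \<longlongrightarrow> 0) at_top" .
  moreover have "\<forall>\<^sub>F s in at_top. K * (exp (- u * ln s) / ln s + a * exp (- v * ln s)
      + exp (- h * (ln s)\<^sup>2 + (c + 1) * ln s) / ln s)
    = K * s / ln s * (exp (- b\<^sub>1 * ln s) + a * ln s * exp (- b\<^sub>2 * ln s)
      + exp (- h * (ln s)\<^sup>2 + c * ln s))"
    using eventually_gt_at_top[of 1]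
  proof eventually_elim
    case (elim s)
    define L where "L = ln s"
    have s: "s = exp L" and L: "L > 0" using elim by (auto simp: L_def)
    have "exp (- u * L) = s * exp (- b\<^sub>1 * L)" "exp (- v * L) = s * exp (- b\<^sub>2 * L)"
      "exp (- h * L\<^sup>2 + (c + 1) * L) = s * exp (- h * L\<^sup>2 + c * L)"
      unfolding s exp_add[symmetric] u_def v_def by (simp_all add: algebra_simps)
    then show ?case unfolding L_def[symmetric] using L by (simp add: field_simps)
  qed
  ultimately show ?thesis by (rule Lim_transform_eventually)
qed

theorem theorem3p3:
  fixes \<eta> \<alpha> \<beta> \<theta> \<kappa> \<rho> \<gamma> :: real
    and T Q r :: "real \<Rightarrow> real"
    and \<mu> :: "real measure"
    and M :: "real \<Rightarrow> 'w measure"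
    and N :: "real \<Rightarrow> 'w \<Rightarrow> nat"
    and X :: "real \<Rightarrow> nat \<Rightarrow> 'w \<Rightarrow> real ^ 'n"
    and W :: "real \<Rightarrow> nat \<Rightarrow> 'w \<Rightarrow> real"
    and E :: "real \<Rightarrow> 'w \<Rightarrow> (real ^ 'n) set set"
  assumes "CARD('n) \<ge> 2" and "\<eta> > 0" and "\<alpha> > real CARD('n)" and "\<beta> > 1"
    and theta: "\<theta> = measure lborel (ball (0 :: real ^ 'n) 1)"
    and mu: "weight_law \<beta> \<mu>"
    and kappa: "\<kappa> = (LINT z:ball (0 :: real ^ 'n) 1|lborel.
        (LINT w|\<mu>. 1 - exp (- (\<eta> * w / (norm z powr \<alpha>)))))"
    and T: "\<And>g. g > 0 \<Longrightarrow>
        T g = 1 - exp (- \<eta> * (1 + (\<kappa> / (g * \<theta>)) powr (1 / real CARD('n))) powr (- \<alpha>))"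
    and Q: "\<And>g. g > 0 \<Longrightarrow> Q g = g * T g"
    and rho: "\<rho> > 0" "Q \<rho> = 1"
    and gamma: "\<gamma> > \<rho>"
    and r: "\<And>s. s > 1 \<Longrightarrow> r s > 0 \<and> r s ^ CARD('n) = \<gamma> * ln s / (\<kappa> * s)"
    and graph: "\<And>s. s > 1 \<Longrightarrow>
        weighted_random_graph (M s) s (N s) (X s) \<eta> \<alpha> \<beta> (r s) (W s) (E s)"
  shows "((\<lambda>s. measure (M s)
            {\<omega> \<in> space (M s). graph_connected (point_set (N s) (X s) \<omega>) (E s \<omega>)})
          \<longlongrightarrow> 1) at_top"
proof -
  define d where "d = CARD('n)"
  have "\<gamma> > 0" using rho gamma by simp
  have "0 < r 2 ^ d" using r[of 2] by simp
  moreover have "r 2 ^ d = \<gamma> * ln 2 / (\<kappa> * 2)" using r[of 2] by (simp add: d_def)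
  ultimately have "0 < \<gamma> * ln 2 / (\<kappa> * 2)" by simp
  then have "\<kappa> > 0" using mult_pos_pos[OF \<open>\<gamma> > 0\<close>, of "ln 2"] by (simp add: zero_less_divide_iff)
  have "\<kappa> \<le> \<theta>" unfolding kappa theta
    by (rule integral_unit_ball_le_volume) (use mu in \<open>simp_all add: weight_law_def\<close>)

  define p where "p = 1 - exp (- \<eta>)"
  have p: "0 < p" "p < 1" using \<open>\<eta> > 0\<close> by (simp_all add: p_def)
  \<comment> \<open>\<open>T\<close> is the connection probability of two vertices of weight 1 at a distance larger than \<open>r\<close>,
    so it is at most \<open>p\<close>.\<close>
  have "(1 + (\<kappa> / (\<rho> * \<theta>)) powr (1 / real CARD('n))) powr (- \<alpha>) \<le> 1 powr (- \<alpha>)"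
    using \<open>\<alpha> > real CARD('n)\<close> by (intro powr_mono2') auto
  then have "\<eta> * (1 + (\<kappa> / (\<rho> * \<theta>)) powr (1 / real CARD('n))) powr (- \<alpha>) \<le> \<eta> * 1"
    using \<open>\<eta> > 0\<close> by (intro mult_left_mono) auto
  then have "T \<rho> \<le> p" unfolding T[OF rho(1)] p_def by simp
  moreover have "\<rho> * T \<rho> = 1" using Q rho by simp
  ultimately have "1 \<le> \<rho> * p" using rho(1) by (metis mult_left_mono less_imp_le)
  then have "1 < \<gamma> * p" using gamma p by (meson less_le_trans mult_strict_right_mono order_le_less_trans)
  \<comment> \<open>The expected number of points in a ball of radius \<open>r\<close> is \<open>a log s\<close>.\<close>
  define a where "a = \<theta> * \<gamma> / \<kappa>"
  have "\<gamma> * 1 \<le> \<gamma> * (\<theta> / \<kappa>)" using \<open>\<gamma> > 0\<close> \<open>\<kappa> > 0\<close> \<open>\<kappa> \<le> \<theta>\<close> by (intro mult_left_mono) auto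
  then have "\<gamma> \<le> a" by (simp add: a_def mult.commute)
  then have "1 < a * p" using \<open>1 < \<gamma> * p\<close> p by (meson less_le_trans mult_right_mono less_imp_le)

  \<comment> \<open>As \<open>a p > 1\<close>, there is room for a small loss \<open>\<delta>\<close> in the radius and for a finite Chernoff
    parameter \<open>t\<close>; both are obtained from one large index \<open>k\<close>.\<close>
  have "(\<lambda>k. a * (1 - 1 / real (k + 2)) ^ d * ((1 - exp (- real k)) * p)) \<longlonglongrightarrow> a * (1 - 0) ^ d * ((1 - 0) * p)"
    by (intro tendsto_intros; real_asymp)
  then have "\<forall>\<^sub>F k in sequentially. 1 < a * (1 - 1 / real (k + 2)) ^ d * ((1 - exp (- real k)) * p)"
    using \<open>1 < a * p\<close> by (intro order_tendstoD) auto
  then obtain k :: nat where k: "1 < a * (1 - 1 / real (k + 2)) ^ d * ((1 - exp (- real k)) * p)"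
    by (auto simp: eventually_sequentially)
  define \<delta> where "\<delta> = 1 / real (k + 2)"
  define t where "t = real k"
  have \<delta>: "0 < \<delta>" "\<delta> \<le> 1/2" by (auto simp: \<delta>_def field_simps)
  define b where "b = a * (1 - \<delta>) ^ d"
  define q where "q = (1 - exp (- t)) * p"
  have "0 \<le> t" by (simp add: t_def)
  have "0 \<le> q" "q \<le> 1" using p \<open>0 \<le> t\<close> by (auto simp: q_def intro!: mult_le_one)
  have "1 < b * q" using k by (simp add: b_def q_def \<delta>_def t_def)
  have "0 \<le> b" using \<delta> \<open>\<gamma> \<le> a\<close> \<open>\<gamma> > 0\<close> by (simp add: b_def)
  then have "b * q \<le> b * 1" using \<open>q \<le> 1\<close> by (intro mult_left_mono) auto
  then have "1 < b" using \<open>1 < b * q\<close> by simp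
  \<comment> \<open>What remains of the excess over 1 pays for the factor \<open>s powr (t \<epsilon>)\<close> with which the
    Chernoff bound allows up to \<open>\<epsilon> log s\<close> neighbours.\<close>
  define \<epsilon> where "\<epsilon> = (b * q - 1) / (2 * (t + 1))"
  have "\<epsilon> > 0" using \<open>1 < b * q\<close> \<open>0 \<le> t\<close> by (simp add: \<epsilon>_def)
  have "\<epsilon> * (t + 1) = (b * q - 1) / 2" using \<open>0 \<le> t\<close> by (simp add: \<epsilon>_def divide_simps)
  then have "1 < b * q - t * \<epsilon>" using \<open>1 < b * q\<close> \<open>\<epsilon> > 0\<close> by (simp add: algebra_simps)

  \<comment> \<open>\<open>K s / log s\<close> bounds the number of centres in the net of mesh \<open>\<delta> r / 2\<close>.\<close>
  define K where "K = (4 * real d / \<delta>) ^ d * (\<kappa> / \<gamma>)"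
  define h where "h = \<eta> * 6 powr - \<alpha> * \<epsilon>\<^sup>2"
  define err where "err s = K * s / ln s * (exp (- b * ln s) + b * ln s * exp (- (b * q - t * \<epsilon>) * ln s)
      + exp (- h * (ln s)\<^sup>2 + 3 * (a * 3 ^ d) * ln s))" for s
  have "h > 0" using \<open>\<eta> > 0\<close> \<open>\<epsilon> > 0\<close> by (simp add: h_def)
  have err: "(err \<longlongrightarrow> 0) at_top"
    unfolding err_def
    by (rule failure_bound_tendsto_zero[OF \<open>1 < b\<close> \<open>1 < b * q - t * \<epsilon>\<close> \<open>h > 0\<close>])

  have "((\<lambda>s. \<gamma> * ln s / (\<kappa> * s)) \<longlongrightarrow> 0) at_top" using \<open>\<kappa> > 0\<close> by real_asymp
  then have "\<forall>\<^sub>F s in at_top. \<gamma> * ln s / (\<kappa> * s) < (1/6) ^ d" by (rule order_tendstoD) simp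
  then have small: "\<forall>\<^sub>F s in at_top. s > 1 \<and> 3 * r s \<le> 1/2"
    using eventually_gt_at_top[of 1]
  proof eventually_elim
    case (elim s)
    then have "r s ^ d < (1/6) ^ d" using r by (simp add: d_def)
    then have "r s < 1/6" by (rule power_less_imp_less_base) simp
    then show ?case using elim by simp
  qed

  let ?P = "\<lambda>s. measure (M s) {\<omega> \<in> space (M s). graph_connected (point_set (N s) (X s) \<omega>) (E s \<omega>)}"
  have lower: "\<forall>\<^sub>F s in at_top. 1 - err s \<le> ?P s"
    using small
  proof eventually_elim
    case (elim s)
    then have s: "s > 1" "ln s > 0" and rs: "r s > 0" "r s ^ d = \<gamma> * ln s / (\<kappa> * s)"
      using r[of s] by (auto simp: d_def)
    interpret weighted_random_graph "M s" s "N s" "X s" \<eta> \<alpha> \<beta> "r s" "W s" "E s"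
      by (rule graph[OF s(1)])
    have l: "b * ln s = s * (\<theta> * ((1 - \<delta>) * r s) ^ CARD('n))"
      using rs(2) s \<open>\<kappa> > 0\<close> by (simp add: b_def a_def power_mult_distrib flip: d_def)
    have m: "a * 3 ^ d * ln s = s * (\<theta> * (3 * r s) ^ CARD('n))"
      using rs(2) s \<open>\<kappa> > 0\<close> by (simp add: a_def power_mult_distrib flip: d_def)
    have "\<alpha> > 0" using \<open>\<alpha> > real CARD('n)\<close> by (rule le_less_trans[rotated]) simp
    have "1 - (4 * real CARD('n) / (\<delta> * r s)) ^ CARD('n) * (exp (- (b * ln s))
        + exp (t * (\<epsilon> * ln s)) * (b * ln s * exp (- (b * ln s) * ((1 - exp (- t)) * (1 - exp (- \<eta>)))))
        + exp (- \<eta> * 6 powr - \<alpha> * (\<epsilon> * ln s)\<^sup>2) * exp (3 * (a * 3 ^ d * ln s))) \<le> ?P s"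
      by (rule prob_graph_connected_ge[OF \<open>\<eta> > 0\<close> \<open>\<alpha> > 0\<close> rs(1) _ _ \<delta> \<open>0 \<le> t\<close> _ theta l m])
        (use s elim \<open>\<epsilon> > 0\<close> in auto)
    also have "(4 * real CARD('n) / (\<delta> * r s)) ^ CARD('n) = K * s / ln s"
      using rs(2) s \<open>\<gamma> > 0\<close> \<open>\<kappa> > 0\<close>
      by (simp add: K_def power_divide power_mult_distrib flip: d_def)
    also have "exp (t * (\<epsilon> * ln s)) * (b * ln s * exp (- (b * ln s) * ((1 - exp (- t)) * (1 - exp (- \<eta>)))))
        = b * ln s * exp (- (b * q - t * \<epsilon>) * ln s)"
      by (simp add: q_def p_def algebra_simps flip: exp_add)
    also have "exp (- \<eta> * 6 powr - \<alpha> * (\<epsilon> * ln s)\<^sup>2) * exp (3 * (a * 3 ^ d * ln s))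
        = exp (- h * (ln s)\<^sup>2 + 3 * (a * 3 ^ d) * ln s)"
      by (simp add: h_def power_mult_distrib algebra_simps flip: exp_add)
    finally show ?case by (simp add: err_def)
  qed
  have upper: "\<forall>\<^sub>F s in at_top. ?P s \<le> 1"
    using eventually_gt_at_top[of 1]
  proof eventually_elim
    case (elim s)
    interpret weighted_random_graph "M s" s "N s" "X s" \<eta> \<alpha> \<beta> "r s" "W s" "E s"
      by (rule graph[OF elim])
    show ?case by (rule prob_le_1)
  qed
  have "((\<lambda>s. 1 - err s) \<longlongrightarrow> 1 - 0) at_top" by (intro tendsto_intros err)
  then show ?thesis using tendsto_sandwich[OF lower upper] by simp
qed

end
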